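(* Let $T$ be a complete first-order theory which is NIP, let $M$ be a model of $T$, and let $G$ be a group definable in $M$. Let $$1\rightarrow D\rightarrow G \stackrel{\pi}{\rightarrow} S\rightarrow 1$$ be a definable exact sequence of groups definable in $M$, where $D$ is definably amenable. Then, as $G$-flows, $$\Pi^{\mathrm{def}}(G)\cong \Pi^{\mathrm{def}}(S)|_\pi .$$
   Context: "Definable" means definable in $M$ with parameters from $M$; a definable exact sequence is an exact sequence of definable groups whose maps are definable. A definable group $H$ is definably amenable if there is a left $H$-invariant finitely additive probability measure on the Boolean algebra of definable subsets of $H$ (a left-invariant Keisler measure over $M$). For a definable group $H$, an $H$-flow is a nonempty compact Hausdorff space $X$ with an action of $H$ on $X$ by homeomorphisms. It is a definable $H$-flow if for every $x\in X$ and any disjoint closed subsets $C_1,C_2\subseteq X$ there is a definable subset of $H$ separating $f_x^{-1}(C_1)$ and $f_x^{-1}(C_2)$ (containing one and disjoint from the other), where $f_x:H\to X$, $h\mapsto hx$. A subflow is a closed $H$-invariant subset; $X$ is minimal if it has no nonempty proper subflow. $X$ is proximal if for all $x,y\in X$ there is a net $(h_i)_i$ in $H$ with $\lim_i h_ix=\lim_i h_iy$. $\Pi^{\mathrm{def}}(H)$ denotes the universal minimal proximal definable $H$-flow: a minimal proximal definable $H$-flow admitting a continuous surjective $H$-equivariant map onto every minimal proximal definable $H$-flow. It exists and is unique up to isomorphism of $H$-flows. For an $S$-flow $X$, $X|_\pi$ denotes $X$ regarded as a $G$-flow via $gx:=\pi(g)x$ for $g\in G$, $x\in X$. Isomorphism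 $\cong$ of flows means equivariant homeomorphism. *)

theory Defs
  imports "HOL-Analysis.Analysis" "HOL-Algebra.Group_Action"
begin

section \<open>First-order logic\<close>

text \<open>A language is given by its sets of function and relation symbols, each listed together with
  its arity; constants are function symbols of arity 0.  Variables are named by natural numbers.\<close>

record ('f, 'r) lang =
  lang_funs :: "('f \<times> nat) set"
  lang_rels :: "('r \<times> nat) set"

datatype 'f tm = Var nat | App 'f "'f tm list"

datatype ('f, 'r) fm =
    Falsum
  | Eq "'f tm" "'f tm"
  | Rel 'r "'f tm list"
  | Imp "('f, 'r) fm" "('f, 'r) fm"
  | All nat "('f, 'r) fm"

abbreviation Neg :: "('f, 'r) fm \<Rightarrow> ('f, 'r) fm" where
  "Neg \<phi> \<equiv> Imp \<phi> Falsum"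

fun wf_tm :: "('f, 'r) lang \<Rightarrow> 'f tm \<Rightarrow> bool" where
  "wf_tm L (Var i) \<longleftrightarrow> True"
| "wf_tm L (App f ts) \<longleftrightarrow> (f, length ts) \<in> lang_funs L \<and> (\<forall>t\<in>set ts. wf_tm L t)"

primrec wf_fm :: "('f, 'r) lang \<Rightarrow> ('f, 'r) fm \<Rightarrow> bool" where
  "wf_fm L Falsum \<longleftrightarrow> True"
| "wf_fm L (Eq s t) \<longleftrightarrow> wf_tm L s \<and> wf_tm L t"
| "wf_fm L (Rel r ts) \<longleftrightarrow> (r, length ts) \<in> lang_rels L \<and> (\<forall>t\<in>set ts. wf_tm L t)"
| "wf_fm L (Imp \<phi> \<psi>) \<longleftrightarrow> wf_fm L \<phi> \<and> wf_fm L \<psi>"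
| "wf_fm L (All i \<phi>) \<longleftrightarrow> wf_fm L \<phi>"

fun fv_tm :: "'f tm \<Rightarrow> nat set" where
  "fv_tm (Var i) = {i}"
| "fv_tm (App f ts) = (\<Union>t\<in>set ts. fv_tm t)"

primrec fv :: "('f, 'r) fm \<Rightarrow> nat set" where
  "fv Falsum = {}"
| "fv (Eq s t) = fv_tm s \<union> fv_tm t"
| "fv (Rel r ts) = (\<Union>t\<in>set ts. fv_tm t)"
| "fv (Imp \<phi> \<psi>) = fv \<phi> \<union> fv \<psi>"
| "fv (All i \<phi>) = fv \<phi> - {i}"

definition is_sentence :: "('f, 'r) lang \<Rightarrow> ('f, 'r) fm \<Rightarrow> bool" where
  "is_sentence L \<phi> \<longleftrightarrow> wf_fm L \<phi> \<and> fv \<phi> = {}"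

record ('f, 'r, 'a) struct =
  dom :: "'a set"
  fun_int :: "'f \<Rightarrow> 'a list \<Rightarrow> 'a"
  rel_int :: "'r \<Rightarrow> 'a list \<Rightarrow> bool"

definition tuples :: "('f, 'r, 'a) struct \<Rightarrow> nat \<Rightarrow> 'a list set" where
  "tuples M n = {xs. length xs = n \<and> set xs \<subseteq> dom M}"

definition is_structure :: "('f, 'r) lang \<Rightarrow> ('f, 'r, 'a) struct \<Rightarrow> bool" where
  "is_structure L M \<longleftrightarrow>
     dom M \<noteq> {} \<and> (\<forall>(f, k)\<in>lang_funs L. \<forall>xs\<in>tuples M k. fun_int M f xs \<in> dom M)"

primrec eval_tm :: "('f, 'r, 'a) struct \<Rightarrow> (nat \<Rightarrow> 'a) \<Rightarrow> 'f tm \<Rightarrow> 'a" where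
  "eval_tm M e (Var i) = e i"
| "eval_tm M e (App f ts) = fun_int M f (map (eval_tm M e) ts)"

primrec sat :: "('f, 'r, 'a) struct \<Rightarrow> (nat \<Rightarrow> 'a) \<Rightarrow> ('f, 'r) fm \<Rightarrow> bool" where
  "sat M e Falsum \<longleftrightarrow> False"
| "sat M e (Eq s t) \<longleftrightarrow> eval_tm M e s = eval_tm M e t"
| "sat M e (Rel r ts) \<longleftrightarrow> rel_int M r (map (eval_tm M e) ts)"
| "sat M e (Imp \<phi> \<psi>) \<longleftrightarrow> (sat M e \<phi> \<longrightarrow> sat M e \<psi>)"
| "sat M e (All i \<phi>) \<longleftrightarrow> (\<forall>x\<in>dom M. sat M (e(i := x)) \<phi>)"

definition is_model :: "('f, 'r) lang \<Rightarrow> ('f, 'r, 'a) struct \<Rightarrow> ('f, 'r) fm set \<Rightarrow> bool" where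
  "is_model L M T \<longleftrightarrow> is_structure L M \<and> (\<forall>\<phi>\<in>T. \<forall>e. range e \<subseteq> dom M \<longrightarrow> sat M e \<phi>)"

text \<open>Consistency and consequence are tested in models whose universe consists of elements of the
  type of formulas.  That type is infinite and at least as large as the language, so by the
  downward Loewenheim-Skolem theorem this is the same as testing all models.\<close>

definition complete_theory :: "('f, 'r) lang \<Rightarrow> ('f, 'r) fm set \<Rightarrow> bool" where
  "complete_theory L T \<longleftrightarrow>
     (\<forall>\<phi>\<in>T. is_sentence L \<phi>) \<and>
     (\<exists>N :: ('f, 'r, ('f, 'r) fm) struct. is_model L N T) \<and>
     (\<forall>\<phi>. is_sentence L \<phi> \<longrightarrow>
        (\<forall>N :: ('f, 'r, ('f, 'r) fm) struct. is_model L N T \<longrightarrow> is_model L N {\<phi>}) \<or>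
        (\<forall>N :: ('f, 'r, ('f, 'r) fm) struct. is_model L N T \<longrightarrow> is_model L N {Neg \<phi>}))"

text \<open>The formula \<open>\<phi>(x;y)\<close>, where \<open>x\<close> consists of the first \<open>m\<close> variables and \<open>y\<close> of the next \<open>n\<close>,
  is NIP in \<open>N\<close> if for some \<open>k\<close> it shatters no \<open>k\<close> tuples.\<close>

definition nip_formula :: "('f, 'r, 'a) struct \<Rightarrow> nat \<Rightarrow> nat \<Rightarrow> ('f, 'r) fm \<Rightarrow> bool" where
  "nip_formula N m n \<phi> \<longleftrightarrow>
     (\<exists>k. \<not> (\<exists>(a :: nat \<Rightarrow> 'a list) (b :: nat set \<Rightarrow> 'a list).
        (\<forall>i<k. a i \<in> tuples N m) \<and> (\<forall>J\<subseteq>{..<k}. b J \<in> tuples N n) \<and>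
        (\<forall>i<k. \<forall>J\<subseteq>{..<k}. sat N ((!) (a i @ b J)) \<phi> \<longleftrightarrow> i \<in> J)))"

text \<open>The models of \<open>T\<close> in which NIP is tested have their universe in the type \<open>'a\<close>.  Shattering of
  \<open>k\<close> tuples is expressed by a first-order sentence, so if \<open>T\<close> is complete then a formula is NIP in
  one model of \<open>T\<close> iff it is NIP in all of them; the choice of \<open>'a\<close> is immaterial as soon as it
  carries a model of \<open>T\<close>.\<close>

definition nip_theory :: "('f, 'r) lang \<Rightarrow> ('f, 'r) fm set \<Rightarrow> 'a itself \<Rightarrow> bool" where
  "nip_theory L T _ \<longleftrightarrow>
     (\<forall>\<phi> m n. wf_fm L \<phi> \<and> fv \<phi> \<subseteq> {..<m + n} \<longrightarrow>
        (\<forall>N :: ('f, 'r, 'a) struct. is_model L N T \<longrightarrow> nip_formula N m n \<phi>))"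


section \<open>Definable sets, groups and maps\<close>

definition definable :: "('f, 'r) lang \<Rightarrow> ('f, 'r, 'a) struct \<Rightarrow> nat \<Rightarrow> 'a list set \<Rightarrow> bool" where
  "definable L M n A \<longleftrightarrow>
     (\<exists>\<phi> ps. wf_fm L \<phi> \<and> set ps \<subseteq> dom M \<and> fv \<phi> \<subseteq> {..<n + length ps} \<and>
        A = {xs \<in> tuples M n. sat M ((!) (xs @ ps)) \<phi>})"

definition definable_group ::
  "('f, 'r) lang \<Rightarrow> ('f, 'r, 'a) struct \<Rightarrow> nat \<Rightarrow> 'a list monoid \<Rightarrow> bool" where
  "definable_group L M n H \<longleftrightarrow>
     group H \<and> definable L M n (carrier H) \<and>
     definable L M (n + n + n) {x @ y @ (x \<otimes>\<^bsub>H\<^esub> y) | x y. x \<in> carrier H \<and> y \<in> carrier H}"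

definition definable_subset ::
  "('f, 'r) lang \<Rightarrow> ('f, 'r, 'a) struct \<Rightarrow> nat \<Rightarrow> 'a list monoid \<Rightarrow> 'a list set \<Rightarrow> bool" where
  "definable_subset L M n H A \<longleftrightarrow> definable L M n A \<and> A \<subseteq> carrier H"

definition definable_hom ::
  "('f, 'r) lang \<Rightarrow> ('f, 'r, 'a) struct \<Rightarrow> nat \<Rightarrow> 'a list monoid \<Rightarrow> nat \<Rightarrow> 'a list monoid \<Rightarrow>
     ('a list \<Rightarrow> 'a list) \<Rightarrow> bool" where
  "definable_hom L M m H n K f \<longleftrightarrow>
     f \<in> hom H K \<and> definable L M (m + n) {x @ f x | x. x \<in> carrier H}"

definition definable_exact_sequence ::
  "('f, 'r) lang \<Rightarrow> ('f, 'r, 'a) struct \<Rightarrow> nat \<Rightarrow> 'a list monoid \<Rightarrow> ('a list \<Rightarrow> 'a list) \<Rightarrow>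
     nat \<Rightarrow> 'a list monoid \<Rightarrow> ('a list \<Rightarrow> 'a list) \<Rightarrow> nat \<Rightarrow> 'a list monoid \<Rightarrow> bool" where
  "definable_exact_sequence L M d D \<iota> g G \<pi> s S \<longleftrightarrow>
     definable_group L M d D \<and> definable_group L M g G \<and> definable_group L M s S \<and>
     definable_hom L M d D g G \<iota> \<and> definable_hom L M g G s S \<pi> \<and>
     inj_on \<iota> (carrier D) \<and> \<iota> ` carrier D = kernel G S \<pi> \<and> \<pi> ` carrier G = carrier S"

definition definably_amenable ::
  "('f, 'r) lang \<Rightarrow> ('f, 'r, 'a) struct \<Rightarrow> nat \<Rightarrow> 'a list monoid \<Rightarrow> bool" where
  "definably_amenable L M n H \<longleftrightarrow>
     (\<exists>\<mu> :: 'a list set \<Rightarrow> real.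
        (\<forall>A. definable_subset L M n H A \<longrightarrow> 0 \<le> \<mu> A) \<and>
        \<mu> (carrier H) = 1 \<and>
        (\<forall>A B. definable_subset L M n H A \<and> definable_subset L M n H B \<and> A \<inter> B = {} \<longrightarrow>
           \<mu> (A \<union> B) = \<mu> A + \<mu> B) \<and>
        (\<forall>A. \<forall>h\<in>carrier H. definable_subset L M n H A \<longrightarrow> \<mu> (h <#\<^bsub>H\<^esub> A) = \<mu> A))"


section \<open>Flows\<close>

text \<open>As \<open>group_action\<close> maps into the group of extensional bijections of the space, the maps
  \<open>\<alpha> h\<close> are normalised to \<open>undefined\<close> outside the space.\<close>

definition flow :: "'g monoid \<Rightarrow> 'x topology \<Rightarrow> ('g \<Rightarrow> 'x \<Rightarrow> 'x) \<Rightarrow> bool" where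
  "flow H X \<alpha> \<longleftrightarrow>
     topspace X \<noteq> {} \<and> compact_space X \<and> Hausdorff_space X \<and>
     group_action H (topspace X) \<alpha> \<and> (\<forall>h\<in>carrier H. homeomorphic_map X X (\<alpha> h))"

definition separates :: "'g set \<Rightarrow> 'g set \<Rightarrow> 'g set \<Rightarrow> bool" where
  "separates A B C \<longleftrightarrow> (B \<subseteq> A \<and> A \<inter> C = {}) \<or> (C \<subseteq> A \<and> A \<inter> B = {})"

definition definable_flow ::
  "('f, 'r) lang \<Rightarrow> ('f, 'r, 'a) struct \<Rightarrow> nat \<Rightarrow> 'a list monoid \<Rightarrow>
     'x topology \<Rightarrow> ('a list \<Rightarrow> 'x \<Rightarrow> 'x) \<Rightarrow> bool" where
  "definable_flow L M n H X \<alpha> \<longleftrightarrow>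
     flow H X \<alpha> \<and>
     (\<forall>x\<in>topspace X. \<forall>C\<^sub>1 C\<^sub>2. closedin X C\<^sub>1 \<and> closedin X C\<^sub>2 \<and> C\<^sub>1 \<inter> C\<^sub>2 = {} \<longrightarrow>
        (\<exists>A. definable_subset L M n H A \<and>
           separates A {h \<in> carrier H. \<alpha> h x \<in> C\<^sub>1} {h \<in> carrier H. \<alpha> h x \<in> C\<^sub>2}))"

definition subflow :: "'g monoid \<Rightarrow> 'x topology \<Rightarrow> ('g \<Rightarrow> 'x \<Rightarrow> 'x) \<Rightarrow> 'x set \<Rightarrow> bool" where
  "subflow H X \<alpha> Z \<longleftrightarrow> closedin X Z \<and> (\<forall>h\<in>carrier H. \<forall>z\<in>Z. \<alpha> h z \<in> Z)"

definition minimal_flow :: "'g monoid \<Rightarrow> 'x topology \<Rightarrow> ('g \<Rightarrow> 'x \<Rightarrow> 'x) \<Rightarrow> bool" where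
  "minimal_flow H X \<alpha> \<longleftrightarrow>
     flow H X \<alpha> \<and> (\<forall>Z. subflow H X \<alpha> Z \<and> Z \<noteq> {} \<longrightarrow> Z = topspace X)"

text \<open>Nets in \<open>H\<close> are rendered as proper filters containing \<open>H\<close>.\<close>

definition proximal_flow :: "'g monoid \<Rightarrow> 'x topology \<Rightarrow> ('g \<Rightarrow> 'x \<Rightarrow> 'x) \<Rightarrow> bool" where
  "proximal_flow H X \<alpha> \<longleftrightarrow>
     flow H X \<alpha> \<and>
     (\<forall>x\<in>topspace X. \<forall>y\<in>topspace X. \<exists>F z. F \<noteq> bot \<and> (\<forall>\<^sub>F h in F. h \<in> carrier H) \<and>
        limitin X (\<lambda>h. \<alpha> h x) z F \<and> limitin X (\<lambda>h. \<alpha> h y) z F)"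

definition flow_map ::
  "'g monoid \<Rightarrow> 'x topology \<Rightarrow> ('g \<Rightarrow> 'x \<Rightarrow> 'x) \<Rightarrow> 'y topology \<Rightarrow> ('g \<Rightarrow> 'y \<Rightarrow> 'y) \<Rightarrow> ('x \<Rightarrow> 'y) \<Rightarrow> bool"
  where
  "flow_map H X \<alpha> Y \<beta> f \<longleftrightarrow>
     continuous_map X Y f \<and> (\<forall>h\<in>carrier H. \<forall>x\<in>topspace X. f (\<alpha> h x) = \<beta> h (f x))"

definition isomorphic_flows ::
  "'g monoid \<Rightarrow> 'x topology \<Rightarrow> ('g \<Rightarrow> 'x \<Rightarrow> 'x) \<Rightarrow> 'y topology \<Rightarrow> ('g \<Rightarrow> 'y \<Rightarrow> 'y) \<Rightarrow> bool" where
  "isomorphic_flows H X \<alpha> Y \<beta> \<longleftrightarrow> (\<exists>f. flow_map H X \<alpha> Y \<beta> f \<and> homeomorphic_map X Y f)"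

text \<open>The \<open>G\<close>-flow obtained by restricting an action along \<open>\<pi>\<close>.\<close>

definition pullback_action :: "('g \<Rightarrow> 's) \<Rightarrow> ('s \<Rightarrow> 'x \<Rightarrow> 'x) \<Rightarrow> 'g \<Rightarrow> 'x \<Rightarrow> 'x" where
  "pullback_action \<pi> \<beta> = (\<lambda>g. \<beta> (\<pi> g))"

definition minimal_proximal_definable_flow ::
  "('f, 'r) lang \<Rightarrow> ('f, 'r, 'a) struct \<Rightarrow> nat \<Rightarrow> 'a list monoid \<Rightarrow>
     'x topology \<Rightarrow> ('a list \<Rightarrow> 'x \<Rightarrow> 'x) \<Rightarrow> bool" where
  "minimal_proximal_definable_flow L M n H X \<alpha> \<longleftrightarrow>
     definable_flow L M n H X \<alpha> \<and> minimal_flow H X \<alpha> \<and> proximal_flow H X \<alpha>"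

text \<open>\<open>is_\<Pi>_def L M n H X \<alpha>\<close> says that \<open>(X, \<alpha>)\<close> is the universal minimal proximal definable
  \<open>H\<close>-flow.  Its universal property is stated for flows \<open>Y\<close> whose points are sets of sets of tuples.
  Up to isomorphism these are all minimal proximal definable flows, so that the property then holds
  for flows on arbitrary types: see \<open>minimal_proximal_definable_flow_small\<close> and
  \<open>is_\<Pi>_def_universal\<close> below.\<close>

definition is_\<Pi>_def ::
  "('f, 'r) lang \<Rightarrow> ('f, 'r, 'a) struct \<Rightarrow> nat \<Rightarrow> 'a list monoid \<Rightarrow>
     'x topology \<Rightarrow> ('a list \<Rightarrow> 'x \<Rightarrow> 'x) \<Rightarrow> bool" where
  "is_\<Pi>_def L M n H X \<alpha> \<longleftrightarrow>
     minimal_proximal_definable_flow L M n H X \<alpha> \<and>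
     (\<forall>(Y :: 'a list set set topology) \<beta>. minimal_proximal_definable_flow L M n H Y \<beta> \<longrightarrow>
        (\<exists>f. flow_map H X \<alpha> Y \<beta> f \<and> f ` topspace X = topspace Y))"


subsection \<open>Minimal definable flows are small\<close>

lemma group_action_act:
  assumes "group_action H E \<alpha>"
  shows "group H"
    and "\<And>g x. g \<in> carrier H \<Longrightarrow> x \<in> E \<Longrightarrow> \<alpha> g x \<in> E"
    and "\<And>x. x \<in> E \<Longrightarrow> \<alpha> \<one>\<^bsub>H\<^esub> x = x"
    and "\<And>g h x. g \<in> carrier H \<Longrightarrow> h \<in> carrier H \<Longrightarrow> x \<in> E \<Longrightarrow> \<alpha> (g \<otimes>\<^bsub>H\<^esub> h) x = \<alpha> g (\<alpha> h x)"
    and "\<And>g. g \<in> carrier H \<Longrightarrow> \<alpha> g \<in> extensional E"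
proof -
  interpret group_action H E \<alpha> by fact
  show "group H" using group_hom group_hom_def by blast
  show "\<And>g x. g \<in> carrier H \<Longrightarrow> x \<in> E \<Longrightarrow> \<alpha> g x \<in> E" using element_image by blast
  show "\<And>x. x \<in> E \<Longrightarrow> \<alpha> \<one>\<^bsub>H\<^esub> x = x" using id_eq_one by (metis restrict_apply')
  show "\<And>g h x. g \<in> carrier H \<Longrightarrow> h \<in> carrier H \<Longrightarrow> x \<in> E \<Longrightarrow> \<alpha> (g \<otimes>\<^bsub>H\<^esub> h) x = \<alpha> g (\<alpha> h x)"
    using composition_rule by blast
  show "\<And>g. g \<in> carrier H \<Longrightarrow> \<alpha> g \<in> extensional E"
    using bij_prop0 by (simp add: Bij_def)
qed

lemma group_actionI:
  assumes "group H"
    and closed: "\<And>g x. g \<in> carrier H \<Longrightarrow> x \<in> E \<Longrightarrow> \<alpha> g x \<in> E"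
    and one: "\<And>x. x \<in> E \<Longrightarrow> \<alpha> \<one>\<^bsub>H\<^esub> x = x"
    and mult: "\<And>g h x. g \<in> carrier H \<Longrightarrow> h \<in> carrier H \<Longrightarrow> x \<in> E \<Longrightarrow>
                 \<alpha> (g \<otimes>\<^bsub>H\<^esub> h) x = \<alpha> g (\<alpha> h x)"
    and ext: "\<And>g. g \<in> carrier H \<Longrightarrow> \<alpha> g \<in> extensional E"
  shows "group_action H E \<alpha>"
proof -
  interpret H: group H by fact
  have bij: "\<alpha> g \<in> Bij E" if g: "g \<in> carrier H" for g
  proof -
    have "bij_betw (\<alpha> g) E E"
    proof (rule bij_betw_byWitness[where f' = "\<alpha> (inv\<^bsub>H\<^esub> g)"])
      show "\<forall>a\<in>E. \<alpha> (inv\<^bsub>H\<^esub> g) (\<alpha> g a) = a"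
        using g by (metis H.inv_closed H.l_inv mult one)
      show "\<forall>a\<in>E. \<alpha> g (\<alpha> (inv\<^bsub>H\<^esub> g) a) = a"
        using g by (metis H.inv_closed H.r_inv mult one)
    qed (use g closed in auto)
    then show ?thesis using g ext by (simp add: Bij_def)
  qed
  have "\<alpha> \<in> hom H (BijGroup E)"
  proof (rule homI)
    show "\<alpha> g \<in> carrier (BijGroup E)" if "g \<in> carrier H" for g
      using that bij by (simp add: BijGroup_def)
    show "\<alpha> (g \<otimes>\<^bsub>H\<^esub> h) = \<alpha> g \<otimes>\<^bsub>BijGroup E\<^esub> \<alpha> h" if gh: "g \<in> carrier H" "h \<in> carrier H" for g h
    proof (rule extensionalityI[where A = E])
      show "\<alpha> (g \<otimes>\<^bsub>H\<^esub> h) \<in> extensional E" using gh ext by simp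
      show "\<alpha> g \<otimes>\<^bsub>BijGroup E\<^esub> \<alpha> h \<in> extensional E"
        using gh bij by (simp add: BijGroup_def)
    qed (use gh bij mult in \<open>simp add: BijGroup_def compose_def\<close>)
  qed
  then show ?thesis
    unfolding group_action_def group_hom_def group_hom_axioms_def
    using \<open>group H\<close> group_BijGroup by blast
qed

text \<open>Any injection carries a flow to an isomorphic flow on its image.\<close>

lemma minimal_proximal_definable_flow_transport:
  fixes X :: "'x topology" and h :: "'x \<Rightarrow> 'y"
  assumes X: "minimal_proximal_definable_flow L M n H X \<alpha>" and inj: "inj_on h (topspace X)"
  obtains Y \<beta> where "minimal_proximal_definable_flow L M n H Y \<beta>"
    "homeomorphic_map X Y h" "flow_map H X \<alpha> Y \<beta> h"
proof -
  define E where "E = topspace X"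
  define k where "k = inv_into E h"
  define Y where "Y = pullback_topology (h ` E) k X"
  define \<beta> where "\<beta> g = restrict (\<lambda>y. h (\<alpha> g (k y))) (h ` E)" for g
  have kh: "k (h x) = x" if "x \<in> E" for x
    using that inj by (simp add: k_def E_def)
  have kE: "k y \<in> E" and hk: "h (k y) = y" if "y \<in> h ` E" for y
    using that by (auto simp: kh)
  have topY: "topspace Y = h ` E"
    unfolding Y_def topspace_pullback_topology using kE by (auto simp: E_def)
  have contk: "continuous_map Y X k"
    unfolding Y_def by (metis continuous_map_id continuous_map_pullback fun.map_id id_comp)
  have conth: "continuous_map X Y h"
    unfolding Y_def
  proof (rule continuous_map_pullback')
    have "continuous_map X X (\<lambda>x. x)" by simp
    then show "continuous_map X X (k \<circ> h)"
      by (rule continuous_map_eq) (simp add: kh flip: E_def)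
  qed (auto simp: E_def)
  have hms: "homeomorphic_maps X Y h k"
    unfolding homeomorphic_maps_def topY using conth contk kh hk E_def by auto
  then have hm: "homeomorphic_map X Y h" "homeomorphic_map Y X k"
    using homeomorphic_map_maps homeomorphic_maps_sym by blast+
  have fl: "flow H X \<alpha>"
    and def: "\<And>x C\<^sub>1 C\<^sub>2. \<lbrakk>x \<in> E; closedin X C\<^sub>1; closedin X C\<^sub>2; C\<^sub>1 \<inter> C\<^sub>2 = {}\<rbrakk> \<Longrightarrow>
        \<exists>A. definable_subset L M n H A \<and>
           separates A {h \<in> carrier H. \<alpha> h x \<in> C\<^sub>1} {h \<in> carrier H. \<alpha> h x \<in> C\<^sub>2}"
    and min: "\<And>Z. subflow H X \<alpha> Z \<Longrightarrow> Z \<noteq> {} \<Longrightarrow> Z = E"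
    and prox: "\<And>x y. \<lbrakk>x \<in> E; y \<in> E\<rbrakk> \<Longrightarrow> \<exists>F z. F \<noteq> bot \<and> (\<forall>\<^sub>F h in F. h \<in> carrier H) \<and>
        limitin X (\<lambda>h. \<alpha> h x) z F \<and> limitin X (\<lambda>h. \<alpha> h y) z F"
    using X unfolding minimal_proximal_definable_flow_def definable_flow_def minimal_flow_def
      proximal_flow_def E_def by auto
  have act: "group_action H E \<alpha>" using fl by (simp add: flow_def E_def)
  note a = group_action_act[OF act]
  interpret H: group H by (rule a)
  have \<beta>h: "\<beta> g (h x) = h (\<alpha> g x)" if "x \<in> E" for g x
    using that by (simp add: \<beta>_def kh)
  have actY: "group_action H (topspace Y) \<beta>"
    unfolding topY
    by (rule group_actionI) (auto simp: \<beta>h a H.is_group, simp add: \<beta>_def)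
  have homY: "homeomorphic_map Y Y (\<beta> g)" if g: "g \<in> carrier H" for g
  proof -
    have "homeomorphic_map X X (\<alpha> g)" using fl g by (simp add: flow_def)
    then have "homeomorphic_map Y Y (h \<circ> (\<alpha> g \<circ> k))"
      using hm homeomorphic_map_compose by metis
    then show ?thesis
      by (rule homeomorphic_map_eq) (simp add: \<beta>_def topY)
  qed
  have hs: "X homeomorphic_space Y" using hms homeomorphic_space_def by blast
  have flY: "flow H Y \<beta>"
    unfolding flow_def
    using actY homY fl homeomorphic_compact_space[OF hs] homeomorphic_Hausdorff_space[OF hs] topY
    by (auto simp: flow_def E_def)
  have fm: "flow_map H X \<alpha> Y \<beta> h"
    using conth \<beta>h by (simp add: flow_map_def E_def)
  have clX: "closedin X {x \<in> E. h x \<in> C}" if "closedin Y C" for C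
    unfolding E_def using conth that closedin_continuous_map_preimage by blast
  have "definable_flow L M n H Y \<beta>"
    unfolding definable_flow_def
  proof (intro conjI ballI allI impI flY)
    fix y C\<^sub>1 C\<^sub>2
    assume y: "y \<in> topspace Y" and C: "closedin Y C\<^sub>1 \<and> closedin Y C\<^sub>2 \<and> C\<^sub>1 \<inter> C\<^sub>2 = {}"
    obtain x where x: "x \<in> E" "y = h x" using y topY by auto
    have eq: "{g \<in> carrier H. \<beta> g y \<in> C} = {g \<in> carrier H. \<alpha> g x \<in> {x \<in> E. h x \<in> C}}" for C
      using x a(2) by (auto simp: \<beta>h)
    show "\<exists>A. definable_subset L M n H A \<and>
        separates A {g \<in> carrier H. \<beta> g y \<in> C\<^sub>1} {g \<in> carrier H. \<beta> g y \<in> C\<^sub>2}"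
      unfolding eq by (rule def) (use C x clX in auto)
  qed
  moreover have "minimal_flow H Y \<beta>"
    unfolding minimal_flow_def
  proof (intro conjI allI impI flY)
    fix Z assume Z: "subflow H Y \<beta> Z \<and> Z \<noteq> {}"
    then have ZY: "Z \<subseteq> h ` E" using topY closedin_subset subflow_def by metis
    have "subflow H X \<alpha> {x \<in> E. h x \<in> Z}"
      using Z clX a(2) unfolding subflow_def by (auto simp flip: \<beta>h)
    moreover have "{x \<in> E. h x \<in> Z} \<noteq> {}" using Z ZY by auto
    ultimately have "{x \<in> E. h x \<in> Z} = E" by (rule min)
    then show "Z = topspace Y" using ZY topY by auto
  qed
  moreover have "proximal_flow H Y \<beta>"
    unfolding proximal_flow_def
  proof (intro conjI ballI flY)
    fix y y' assume "y \<in> topspace Y" "y' \<in> topspace Y"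
    then obtain x x' where x: "x \<in> E" "y = h x" "x' \<in> E" "y' = h x'" using topY by auto
    obtain F z where F: "F \<noteq> bot" "\<forall>\<^sub>F g in F. g \<in> carrier H"
      and lim: "limitin X (\<lambda>g. \<alpha> g x) z F" "limitin X (\<lambda>g. \<alpha> g x') z F"
      using prox x by blast
    have "limitin Y (h \<circ> (\<lambda>g. \<alpha> g x)) (h z) F" "limitin Y (h \<circ> (\<lambda>g. \<alpha> g x')) (h z) F"
      using continuous_map_limit[OF conth lim(1)] continuous_map_limit[OF conth lim(2)] by simp_all
    then have "limitin Y (\<lambda>g. \<beta> g y) (h z) F" "limitin Y (\<lambda>g. \<beta> g y') (h z) F"
      using x by (auto simp: \<beta>h comp_def)
    then show "\<exists>F z. F \<noteq> bot \<and> (\<forall>\<^sub>F g in F. g \<in> carrier H) \<and>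
        limitin Y (\<lambda>g. \<beta> g y) z F \<and> limitin Y (\<lambda>g. \<beta> g y') z F"
      using F by blast
  qed
  ultimately have "minimal_proximal_definable_flow L M n H Y \<beta>"
    by (simp add: minimal_proximal_definable_flow_def)
  then show thesis using that hm fm by blast
qed

lemma orbit_dense:
  assumes "minimal_flow H X \<alpha>" "x \<in> topspace X"
  shows "X closure_of ((\<lambda>g. \<alpha> g x) ` carrier H) = topspace X"
proof -
  have fl: "flow H X \<alpha>" using assms by (simp add: minimal_flow_def)
  then have act: "group_action H (topspace X) \<alpha>" by (simp add: flow_def)
  note a = group_action_act[OF act]
  interpret H: group H by (rule a)
  let ?O = "(\<lambda>g. \<alpha> g x) ` carrier H"
  have "subflow H X \<alpha> (X closure_of ?O)"
    unfolding subflow_def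
  proof (intro conjI ballI)
    fix g z assume g: "g \<in> carrier H" and z: "z \<in> X closure_of ?O"
    have "continuous_map X X (\<alpha> g)"
      using fl g by (simp add: flow_def homeomorphic_imp_continuous_map)
    then have "\<alpha> g ` (X closure_of ?O) \<subseteq> X closure_of (\<alpha> g ` ?O)"
      by (simp add: continuous_map_image_closure_subset)
    moreover have "\<alpha> g ` ?O \<subseteq> ?O"
      using g assms(2) by (auto simp flip: a(4))
    ultimately show "\<alpha> g z \<in> X closure_of ?O"
      using z closure_of_mono by blast
  qed auto
  moreover have "X closure_of ?O \<noteq> {}"
  proof -
    have "?O \<subseteq> topspace X" using a(2) assms(2) by auto
    then have "?O \<subseteq> X closure_of ?O" by (rule closure_of_subset)
    then show ?thesis using H.one_closed by blast
  qed
  ultimately show ?thesis using assms by (simp add: minimal_flow_def)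
qed

lemma minimal_proximal_definable_flow_small:
  fixes X :: "'x topology"
  assumes X: "minimal_proximal_definable_flow L (M :: ('f, 'r, 'a) struct) n H X \<alpha>"
  obtains Y :: "'a list set set topology" and \<beta> h
  where "minimal_proximal_definable_flow L M n H Y \<beta>"
    "homeomorphic_map X Y h" "flow_map H X \<alpha> Y \<beta> h"
proof -
  have fl: "flow H X \<alpha>" and minf: "minimal_flow H X \<alpha>" and dfl: "definable_flow L M n H X \<alpha>"
    using X by (auto simp: minimal_proximal_definable_flow_def minimal_flow_def)
  have "topspace X \<noteq> {}" using fl unfolding flow_def by (rule conjunct1)
  then obtain x where x: "x \<in> topspace X" by blast
  have nrm: "normal_space X" and t1: "t1_space X"
    using fl by (auto simp: flow_def compact_Hausdorff_or_regular_imp_normal_space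
        Hausdorff_imp_t1_space)
  have dense: "\<exists>g\<in>carrier H. \<alpha> g x \<in> U" if "openin X U" "y \<in> U" for U y
    using orbit_dense[OF minf x] that openin_subset[OF that(1)] unfolding closure_of_def by blast
  define h where "h y = {A. y \<in> X closure_of ((\<lambda>g. \<alpha> g x) ` (A \<inter> carrier H))}" for y
  have sep: "h y \<noteq> h z" if yz: "y \<in> topspace X" "z \<in> topspace X" "y \<noteq> z" for y z
  proof -
    have "closedin X {y}" "closedin X {z}" "disjnt {y} {z}"
      using t1 yz closedin_t1_singleton by auto
    then have "\<exists>U V. openin X U \<and> openin X V \<and> {y} \<subseteq> U \<and> {z} \<subseteq> V \<and>
        disjnt (X closure_of U) (X closure_of V)"
      using nrm yz unfolding normal_space_disjoint_closures by blast
    then obtain U V where UV: "openin X U" "openin X V" "y \<in> U" "z \<in> V"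
        "disjnt (X closure_of U) (X closure_of V)" by blast
    define B where "B W = {g \<in> carrier H. \<alpha> g x \<in> X closure_of W}" for W
    have "\<exists>A. definable_subset L M n H A \<and> separates A (B U) (B V)"
      using dfl x UV(5) closedin_closure_of
      unfolding definable_flow_def B_def disjnt_def by blast
    then obtain A where A: "separates A (B U) (B V)" by blast
    have mem: "A \<in> h w" if "B W \<subseteq> A" "openin X W" "w \<in> W" for W w
    proof -
      have "\<exists>v\<in>(\<lambda>g. \<alpha> g x) ` (A \<inter> carrier H). v \<in> T" if T: "w \<in> T \<and> openin X T" for T
      proof -
        obtain g where g: "g \<in> carrier H" "\<alpha> g x \<in> W \<inter> T"
          using dense[of "W \<inter> T" w] T \<open>openin X W\<close> \<open>w \<in> W\<close> by auto
        then have "g \<in> B W"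
          using closure_of_subset[of W X] openin_subset[OF \<open>openin X W\<close>] by (auto simp: B_def)
        then show ?thesis using g \<open>B W \<subseteq> A\<close> by auto
      qed
      then show ?thesis
        using openin_subset[OF \<open>openin X W\<close>] \<open>w \<in> W\<close> by (auto simp: h_def closure_of_def)
    qed
    have nmem: "A \<notin> h w" if "A \<inter> B W = {}" "openin X W" "w \<in> W" for W w
    proof
      assume "A \<in> h w"
      then have "w \<in> X closure_of ((\<lambda>g. \<alpha> g x) ` (A \<inter> carrier H))" by (simp add: h_def)
      then have "\<exists>v\<in>(\<lambda>g. \<alpha> g x) ` (A \<inter> carrier H). v \<in> W"
        using that(2,3) by (simp add: in_closure_of Bex_def)
      then obtain g where g: "g \<in> A" "g \<in> carrier H" "\<alpha> g x \<in> W" by auto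
      have "W \<subseteq> X closure_of W"
        using that(2) openin_subset by (intro closure_of_subset)
      then have "g \<in> B W" using g by (auto simp: B_def)
      then show False using g that(1) by auto
    qed
    from A show ?thesis
      unfolding separates_def
    proof
      assume "B U \<subseteq> A \<and> A \<inter> B V = {}"
      then have "A \<in> h y" "A \<notin> h z" using mem nmem UV by auto
      then show ?thesis by auto
    next
      assume "B V \<subseteq> A \<and> A \<inter> B U = {}"
      then have "A \<in> h z" "A \<notin> h y" using mem nmem UV by auto
      then show ?thesis by auto
    qed
  qed
  then have "inj_on h (topspace X)" by (meson inj_onI)
  from minimal_proximal_definable_flow_transport[OF X this] show thesis using that by metis
qed

lemma is_\<Pi>_def_universal:
  assumes "is_\<Pi>_def L M n H X \<alpha>" "minimal_proximal_definable_flow L M n H Y \<beta>"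
  shows "\<exists>f. flow_map H X \<alpha> Y \<beta> f \<and> f ` topspace X = topspace Y"
proof -
  from minimal_proximal_definable_flow_small[OF assms(2)]
  obtain Z :: "'c list set set topology" and \<gamma> h where
    Z: "minimal_proximal_definable_flow L M n H Z \<gamma>"
      "homeomorphic_map Y Z h" "flow_map H Y \<beta> Z \<gamma> h" by metis
  obtain f where f: "flow_map H X \<alpha> Z \<gamma> f" "f ` topspace X = topspace Z"
    using assms(1) Z(1) unfolding is_\<Pi>_def_def by blast
  obtain k where k: "homeomorphic_maps Y Z h k" using Z(2) homeomorphic_map_maps by blast
  have actY: "group_action H (topspace Y) \<beta>"
    using assms(2) by (simp add: minimal_proximal_definable_flow_def minimal_flow_def flow_def)
  have kZ: "k z \<in> topspace Y" "h (k z) = z" if "z \<in> topspace Z" for z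
    using that k by (auto simp: homeomorphic_maps_def continuous_map_def)
  have kh: "k (h y) = y" if "y \<in> topspace Y" for y
    using that k by (auto simp: homeomorphic_maps_def)
  have fZ: "f x \<in> topspace Z" if "x \<in> topspace X" for x
    using that f(2) by blast
  have eqv: "k (f (\<alpha> g x)) = \<beta> g (k (f x))" if "g \<in> carrier H" "x \<in> topspace X" for g x
  proof -
    have "f (\<alpha> g x) = \<gamma> g (f x)" using f(1) that by (simp add: flow_map_def)
    also have "\<dots> = h (\<beta> g (k (f x)))"
      using Z(3) that kZ[OF fZ[OF that(2)]] by (simp add: flow_map_def)
    finally show ?thesis
      using that kh group_action_act(2)[OF actY] kZ fZ by simp
  qed
  have "continuous_map X Y (k \<circ> f)"
  proof (rule continuous_map_compose)
    show "continuous_map X Z f" using f(1) by (simp add: flow_map_def)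
    show "continuous_map Z Y k" using k by (simp add: homeomorphic_maps_def)
  qed
  then have "flow_map H X \<alpha> Y \<beta> (k \<circ> f)"
    using eqv by (simp add: flow_map_def)
  moreover have "(k \<circ> f) ` topspace X = topspace Y"
  proof -
    have "homeomorphic_map Z Y k"
      using k homeomorphic_maps_map by blast
    then have "k ` topspace Z = topspace Y" by (rule homeomorphic_imp_surjective_map)
    then show ?thesis using f(2) by (metis image_comp)
  qed
  ultimately show ?thesis by blast
qed

end

theory Submission
  imports Defs "HOL-Real_Asymp.Real_Asymp"
begin

text \<open>
  The heart of the matter is that \<open>D\<close> acts trivially on every minimal proximal definable
  \<open>G\<close>-flow \<open>X\<close> (\<open>definably_amenable_kernel_acts_trivially\<close>).  Granting this, \<open>X\<close> is
  a flow of \<open>S\<close>, and because images and preimages under \<open>\<pi>\<close> of definable sets are definable,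
  minimal proximal definable \<open>S\<close>-flows are the same as minimal proximal definable \<open>G\<close>-flows
  on which the kernel is trivial (\<open>minimal_proximal_definable_flow_along_surjection\<close>).  The two
  universal properties therefore give \<open>G\<close>-maps in both directions between the two universal flows,
  and these are mutually inverse since a minimal proximal flow has no endomorphism but the identity
  (\<open>minimal_proximal_endomorphism\<close>).

  To see that \<open>D\<close> acts trivially, fix \<open>x\<^sub>0 \<in> X\<close> and let \<open>\<nu>\<close> be the image in \<open>X\<close> of the invariant
  measure of \<open>D\<close> under \<open>d \<mapsto> d x\<^sub>0\<close>.  As \<open>D\<close> is normal, all translates \<open>h \<nu>\<close>, \<open>h \<in> G\<close>, are
  \<open>D\<close>-invariant.  If they could be contracted to a point \<open>z\<close>, then \<open>z\<close> would be fixed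
  by \<open>D\<close>, and by minimality so would be every point.  Proximality by itself contracts only finite sets of
  points (\<open>proximal_contracts_finite\<close>); for measures this is a stronger property, and here NIP is needed.
  The sets \<open>{d \<in> D. h d \<in> B}\<close>, for a definable \<open>B \<subseteq> G\<close> and varying \<open>h \<in> G\<close>, are the fibres of one
  definable relation and so have finite VC dimension.  By the epsilon-net theorem of Haussler and
  Welzl, with \<open>\<epsilon> = 1 / 2\<close> (\<open>eps_net\<close>), the sets of measure at least \<open>1 / 2\<close> in any finite subfamily are
  all met by a number of points that does not depend on the subfamily.  A compactness argument turns these
  into finitely many points of \<open>X\<close> that control all \<open>h\<close> at once (\<open>finite_net_in_flow\<close>): whenever \<open>h\<close>
  brings those points into a small open set, it brings more than half of \<open>\<nu>\<close> into a slightly larger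
  one.  This is contraction enough, for an open set that is moved off itself by an element of
  \<open>D\<close> cannot carry more than half of a \<open>D\<close>-invariant measure.

  As the measure of \<open>D\<close> is merely finitely additive and lives on the definable sets only, the
  epsilon-net theorem is proved by sampling from the finitely many atoms of a finite family of sets.
\<close>

section \<open>A semantic calculus of definability\<close>

primrec rename_tm :: "(nat \<Rightarrow> nat) \<Rightarrow> 'f tm \<Rightarrow> 'f tm" where
  "rename_tm \<sigma> (Var i) = Var (\<sigma> i)"
| "rename_tm \<sigma> (App f ts) = App f (map (rename_tm \<sigma>) ts)"

text \<open>Bound variables are renamed as well; for injective \<open>\<sigma>\<close> this avoids every capture, and
  injective renamings suffice below.\<close>

primrec rename_fm :: "(nat \<Rightarrow> nat) \<Rightarrow> ('f, 'r) fm \<Rightarrow> ('f, 'r) fm" where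
  "rename_fm \<sigma> Falsum = Falsum"
| "rename_fm \<sigma> (Eq s t) = Eq (rename_tm \<sigma> s) (rename_tm \<sigma> t)"
| "rename_fm \<sigma> (Rel r ts) = Rel r (map (rename_tm \<sigma>) ts)"
| "rename_fm \<sigma> (Imp \<phi> \<psi>) = Imp (rename_fm \<sigma> \<phi>) (rename_fm \<sigma> \<psi>)"
| "rename_fm \<sigma> (All i \<phi>) = All (\<sigma> i) (rename_fm \<sigma> \<phi>)"

lemma wf_rename_tm: "wf_tm L t \<Longrightarrow> wf_tm L (rename_tm \<sigma> t)"
  by (induction t) auto

lemma wf_rename_fm: "wf_fm L \<phi> \<Longrightarrow> wf_fm L (rename_fm \<sigma> \<phi>)"
  by (induction \<phi>) (auto simp: wf_rename_tm)

lemma fv_rename_tm: "fv_tm (rename_tm \<sigma> t) = \<sigma> ` fv_tm t"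
  by (induction t) auto

lemma fv_rename_fm: "inj \<sigma> \<Longrightarrow> fv (rename_fm \<sigma> \<phi>) = \<sigma> ` fv \<phi>"
  by (induction \<phi>) (auto simp: fv_rename_tm image_Un image_set_diff image_UN)

lemma eval_rename_tm: "eval_tm M e (rename_tm \<sigma> t) = eval_tm M (e \<circ> \<sigma>) t"
  by (induction t) (auto simp: comp_def intro!: arg_cong[where f = "fun_int M _"])

lemma sat_rename_fm:
  assumes "inj \<sigma>"
  shows "sat M e (rename_fm \<sigma> \<phi>) \<longleftrightarrow> sat M (e \<circ> \<sigma>) \<phi>"
proof (induction \<phi> arbitrary: e)
  case (All i \<phi>)
  have upd: "e(\<sigma> i := x) \<circ> \<sigma> = (e \<circ> \<sigma>)(i := x)" for x
    using assms by (auto simp: fun_eq_iff inj_eq)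
  show ?case unfolding rename_fm.simps sat.simps All.IH upd ..
next
  case (Rel r ts)
  have "eval_tm M e \<circ> rename_tm \<sigma> = eval_tm M (e \<circ> \<sigma>)"
    by (rule ext) (simp add: eval_rename_tm)
  then show ?case by (simp only: rename_fm.simps sat.simps map_map)
qed (simp_all add: eval_rename_tm)

lemma eval_tm_cong: "(\<And>i. i \<in> fv_tm t \<Longrightarrow> e i = e' i) \<Longrightarrow> eval_tm M e t = eval_tm M e' t"
proof (induction t)
  case (App f ts)
  then have "map (eval_tm M e) ts = map (eval_tm M e') ts" by auto
  then show ?case by (metis eval_tm.simps(2))
qed simp

lemma sat_cong: "(\<And>i. i \<in> fv \<phi> \<Longrightarrow> e i = e' i) \<Longrightarrow> sat M e \<phi> \<longleftrightarrow> sat M e' \<phi>"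
proof (induction \<phi> arbitrary: e e')
  case (Eq s t)
  then have "eval_tm M e s = eval_tm M e' s" "eval_tm M e t = eval_tm M e' t"
    by (auto intro!: eval_tm_cong)
  then show ?case by simp
next
  case (Rel r ts)
  then have "map (eval_tm M e) ts = map (eval_tm M e') ts" by (auto intro!: eval_tm_cong)
  then show ?case by (metis sat.simps(3))
next
  case (Imp \<phi> \<psi>)
  from Imp.IH(1)[of e e'] Imp.IH(2)[of e e'] Imp.prems show ?case by simp
next
  case (All i \<phi>)
  have "sat M (e(i := x)) \<phi> \<longleftrightarrow> sat M (e'(i := x)) \<phi>" for x
    by (rule All.IH) (use All.prems in auto)
  then show ?case by simp
qed simp

lemma finite_fv_tm: "finite (fv_tm t)"
  by (induction t) auto

lemma finite_fv: "finite (fv \<phi>)"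
  by (induction \<phi>) (auto simp: finite_fv_tm)

definition merge :: "(nat \<Rightarrow> 'a) \<Rightarrow> (nat \<Rightarrow> 'a) \<Rightarrow> nat \<Rightarrow> 'a" where
  "merge e c i = (if even i then e (i div 2) else c (i div 2))"

text \<open>A predicate on assignments is definable if a formula expresses it whose even variables are the
  variables of the assignment and whose odd variables hold parameters.  In this form definability is
  visibly closed under the logical operations, without any bookkeeping of arities and positions
  of parameters.\<close>

definition definable_pred ::
  "('f, 'r) lang \<Rightarrow> ('f, 'r, 'a) struct \<Rightarrow> ((nat \<Rightarrow> 'a) \<Rightarrow> bool) \<Rightarrow> bool" where
  "definable_pred L M P \<longleftrightarrow>
     (\<exists>\<phi> c. wf_fm L \<phi> \<and> range c \<subseteq> dom M \<and>
        (\<forall>e. range e \<subseteq> dom M \<longrightarrow> (P e \<longleftrightarrow> sat M (merge e c) \<phi>)))"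

lemma definable_pred_cong:
  assumes "definable_pred L M P" "\<And>e. range e \<subseteq> dom M \<Longrightarrow> P e \<longleftrightarrow> Q e"
  shows "definable_pred L M Q"
  using assms unfolding definable_pred_def by metis

lemma definable_pred_imp:
  assumes "definable_pred L M P" "definable_pred L M Q"
  shows "definable_pred L M (\<lambda>e. P e \<longrightarrow> Q e)"
proof -
  obtain \<phi> c where \<phi>: "wf_fm L \<phi>" "range c \<subseteq> dom M"
    "\<And>e. range e \<subseteq> dom M \<Longrightarrow> P e \<longleftrightarrow> sat M (merge e c) \<phi>"
    using assms(1) unfolding definable_pred_def by blast
  obtain \<psi> c' where \<psi>: "wf_fm L \<psi>" "range c' \<subseteq> dom M"
    "\<And>e. range e \<subseteq> dom M \<Longrightarrow> Q e \<longleftrightarrow> sat M (merge e c') \<psi>"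
    using assms(2) unfolding definable_pred_def by blast
  \<comment> \<open>The two parameter sequences are interleaved in turn.\<close>
  define \<sigma> \<tau> :: "nat \<Rightarrow> nat" where "\<sigma> i = (if even i then i else 2 * (i - 1) + 1)"
    and "\<tau> i = (if even i then i else 2 * i + 1)" for i
  have "inj \<sigma>" "inj \<tau>"
    unfolding inj_def \<sigma>_def \<tau>_def by presburger+
  moreover have "merge e (merge c c') \<circ> \<sigma> = merge e c" "merge e (merge c c') \<circ> \<tau> = merge e c'" for e
    by (auto simp: fun_eq_iff merge_def \<sigma>_def \<tau>_def elim!: oddE)
  ultimately have "\<forall>e. range e \<subseteq> dom M \<longrightarrow> ((P e \<longrightarrow> Q e) \<longleftrightarrow>
      sat M (merge e (merge c c')) (Imp (rename_fm \<sigma> \<phi>) (rename_fm \<tau> \<psi>)))"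
    using \<phi>(3) \<psi>(3) by (simp add: sat_rename_fm)
  moreover have "range (merge c c') \<subseteq> dom M"
    using \<phi>(2) \<psi>(2) by (auto simp: merge_def)
  ultimately show ?thesis
    unfolding definable_pred_def
    using \<phi>(1) \<psi>(1) wf_rename_fm by (metis wf_fm.simps(4))
qed

lemma definable_pred_False:
  assumes "dom M \<noteq> {}"
  shows "definable_pred L M (\<lambda>e. False)"
proof -
  obtain a where "a \<in> dom M" using assms by blast
  then show ?thesis
    unfolding definable_pred_def
    by (intro exI[of _ Falsum] exI[of _ "\<lambda>_. a"]) auto
qed

lemma definable_pred_not:
  assumes "dom M \<noteq> {}" "definable_pred L M P"
  shows "definable_pred L M (\<lambda>e. \<not> P e)"
  using definable_pred_imp[OF assms(2) definable_pred_False[OF assms(1)]] by simp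

lemma definable_pred_and:
  assumes "dom M \<noteq> {}" "definable_pred L M P" "definable_pred L M Q"
  shows "definable_pred L M (\<lambda>e. P e \<and> Q e)"
  using definable_pred_not[OF assms(1)
      definable_pred_imp[OF assms(2) definable_pred_not[OF assms(1,3)]]] by simp

lemma definable_pred_all:
  assumes "definable_pred L M P"
  shows "definable_pred L M (\<lambda>e. \<forall>x\<in>dom M. P (e(i := x)))"
proof -
  obtain \<phi> c where \<phi>: "wf_fm L \<phi>" "range c \<subseteq> dom M"
    "\<And>e. range e \<subseteq> dom M \<Longrightarrow> P e \<longleftrightarrow> sat M (merge e c) \<phi>"
    using assms unfolding definable_pred_def by blast
  have "merge (e(i := x)) c = (merge e c)(2 * i := x)" for e x
    by (auto simp: merge_def fun_eq_iff)
  moreover have "range (e(i := x)) \<subseteq> dom M" if "range e \<subseteq> dom M" "x \<in> dom M" for e x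
    using that by auto
  ultimately have "\<forall>e. range e \<subseteq> dom M \<longrightarrow>
      ((\<forall>x\<in>dom M. P (e(i := x))) \<longleftrightarrow> sat M (merge e c) (All (2 * i) \<phi>))"
    using \<phi>(3) by (metis sat.simps(5))
  then show ?thesis
    unfolding definable_pred_def using \<phi>(1,2) by (metis wf_fm.simps(5))
qed

lemma definable_pred_ex:
  assumes "dom M \<noteq> {}" "definable_pred L M P"
  shows "definable_pred L M (\<lambda>e. \<exists>x\<in>dom M. P (e(i := x)))"
  using definable_pred_not[OF assms(1) definable_pred_all[OF definable_pred_not[OF assms]]]
  by simp

definition block :: "(nat \<Rightarrow> 'a) \<Rightarrow> nat \<Rightarrow> nat \<Rightarrow> 'a list" where
  "block e p n = map e [p..<p + n]"

definition put :: "nat \<Rightarrow> 'a list \<Rightarrow> (nat \<Rightarrow> 'a) \<Rightarrow> nat \<Rightarrow> 'a" where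
  "put p xs e = (\<lambda>i. if p \<le> i \<and> i < p + length xs then xs ! (i - p) else e i)"

lemma block_in_tuples: "range e \<subseteq> dom M \<Longrightarrow> block e p n \<in> tuples M n"
  by (auto simp: block_def tuples_def)

lemma range_put:
  assumes "range e \<subseteq> dom M" "xs \<in> tuples M n"
  shows "range (put p xs e) \<subseteq> dom M"
proof
  fix a assume "a \<in> range (put p xs e)"
  then obtain i where i: "a = put p xs e i" by blast
  show "a \<in> dom M"
  proof (cases "p \<le> i \<and> i < p + length xs")
    case True
    then have "i - p < length xs" by linarith
    then have "xs ! (i - p) \<in> set xs" by (rule nth_mem)
    then show ?thesis using i True assms(2) by (auto simp: put_def tuples_def)
  qed (use i assms(1) in \<open>auto simp: put_def\<close>)
qed

lemma block_put_same: "length xs = n \<Longrightarrow> block (put p xs e) p n = xs"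
  by (auto simp: block_def put_def intro: nth_equalityI)

lemma block_put_other: "q + n \<le> p \<or> p + length xs \<le> q \<Longrightarrow> block (put p xs e) q n = block e q n"
  by (auto simp: block_def put_def)

lemma block_add: "block e p (m + n) = block e p m @ block e (p + m) n"
  by (auto simp: block_def nth_append intro!: nth_equalityI)

lemma definable_pred_ex_block:
  fixes M :: "('f, 'r, 'a) struct"
  assumes "dom M \<noteq> {}" "definable_pred L M P"
  shows "definable_pred L M (\<lambda>e. \<exists>xs\<in>tuples M n. P (put p xs e))"
  using assms(2)
proof (induction n arbitrary: P)
  case 0
  have "put p [] e = e" for e :: "nat \<Rightarrow> 'a" by (auto simp: put_def fun_eq_iff)
  moreover have "tuples M 0 = {[]}" by (auto simp: tuples_def)
  ultimately show ?case using 0 by simp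
next
  case (Suc n)
  have snoc: "put p (xs @ [x]) e = (put p xs e)(p + n := x)" if "length xs = n" for xs x and e :: "nat \<Rightarrow> 'a"
    using that by (auto simp: put_def fun_eq_iff nth_append)
  have T: "tuples M (Suc n) = {xs @ [x] | xs x. xs \<in> tuples M n \<and> x \<in> dom M}"
    by (auto simp: tuples_def length_Suc_conv_rev)
  have "definable_pred L M (\<lambda>e. \<exists>xs\<in>tuples M n. \<exists>x\<in>dom M. P ((put p xs e)(p + n := x)))"
    by (rule Suc.IH[OF definable_pred_ex[OF assms(1) Suc.prems]])
  then show ?case
  proof (rule definable_pred_cong)
    fix e :: "nat \<Rightarrow> 'a"
    have "(\<exists>xs\<in>tuples M (Suc n). P (put p xs e)) \<longleftrightarrow>
        (\<exists>xs\<in>tuples M n. \<exists>x\<in>dom M. P (put p (xs @ [x]) e))"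
      unfolding T by blast
    also have "\<dots> \<longleftrightarrow> (\<exists>xs\<in>tuples M n. \<exists>x\<in>dom M. P ((put p xs e)(p + n := x)))"
    proof (intro bex_cong refl)
      fix xs x assume "xs \<in> tuples M n"
      then have "length xs = n" by (simp add: tuples_def)
      then show "P (put p (xs @ [x]) e) = P ((put p xs e)(p + n := x))" by (simp only: snoc)
    qed
    finally show "(\<exists>xs\<in>tuples M n. \<exists>x\<in>dom M. P ((put p xs e)(p + n := x))) \<longleftrightarrow>
        (\<exists>xs\<in>tuples M (Suc n). P (put p xs e))" ..
  qed
qed

text \<open>Since \<open>\<sigma>\<close> may place the coordinates anywhere, several definable relations can be imposed on
  overlapping groups of variables of one assignment.\<close>

lemma definable_pred_mem:
  assumes "definable L M n A" "dom M \<noteq> {}" and inj: "inj_on \<sigma> {..<n}"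
  shows "definable_pred L M (\<lambda>e. map (\<lambda>i. e (\<sigma> i)) [0..<n] \<in> A)"
proof -
  obtain \<phi> ps where \<phi>: "wf_fm L \<phi>" "set ps \<subseteq> dom M" "fv \<phi> \<subseteq> {..<n + length ps}"
    "A = {xs \<in> tuples M n. sat M ((!) (xs @ ps)) \<phi>}"
    using assms(1) unfolding definable_def by blast
  obtain a where a: "a \<in> dom M" using assms(2) by blast
  define c where "c i = (if i < length ps then ps ! i else a)" for i
  define K where "K = Suc (\<Sum>i<n. \<sigma> i)"
  have K: "\<sigma> i < K" if "i < n" for i
    unfolding K_def using that by (auto simp: less_Suc_eq_le intro: member_le_sum)
  \<comment> \<open>Variables from \<open>n + length ps\<close> on can only occur bound; they are moved out of the way.\<close>
  define \<rho> where "\<rho> i = (if i < n then 2 * \<sigma> i else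
    if i < n + length ps then 2 * (i - n) + 1 else 2 * (i + K))" for i
  have "inj \<rho>"
  proof (rule injI)
    fix i j assume eq: "\<rho> i = \<rho> j"
    have *: "i = j" if "\<sigma> i = \<sigma> j" "i < n" "j < n" using inj that by (auto dest: inj_onD)
    have odd: "2 * x \<noteq> Suc (2 * y)" "Suc (2 * y) \<noteq> 2 * x" for x y :: nat by presburger+
    show "i = j"
      using eq K[of i] K[of j] * by (auto simp: \<rho>_def odd split: if_splits)
  qed
  have "map (\<lambda>i. e (\<sigma> i)) [0..<n] \<in> A \<longleftrightarrow> sat M (merge e c) (rename_fm \<rho> \<phi>)"
    if e: "range e \<subseteq> dom M" for e
  proof -
    let ?xs = "map (\<lambda>i. e (\<sigma> i)) [0..<n]"
    have "?xs \<in> tuples M n" using e by (auto simp: tuples_def)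
    then have "?xs \<in> A \<longleftrightarrow> sat M ((!) (?xs @ ps)) \<phi>" by (simp add: \<phi>(4))
    also have "\<dots> \<longleftrightarrow> sat M (merge e c \<circ> \<rho>) \<phi>"
      by (rule sat_cong) (use \<phi>(3) in \<open>auto simp: merge_def \<rho>_def c_def nth_append\<close>)
    also have "\<dots> \<longleftrightarrow> sat M (merge e c) (rename_fm \<rho> \<phi>)"
      by (simp add: sat_rename_fm[OF \<open>inj \<rho>\<close>])
    finally show ?thesis .
  qed
  moreover have "range c \<subseteq> dom M" using \<phi>(2) a by (auto simp: c_def)
  ultimately show ?thesis
    unfolding definable_pred_def using wf_rename_fm[OF \<phi>(1)] by blast
qed

lemma definable_if_definable_pred:
  assumes A: "A \<subseteq> tuples M n" and P: "definable_pred L M P" and "dom M \<noteq> {}"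
    and AP: "\<And>e. range e \<subseteq> dom M \<Longrightarrow> block e 0 n \<in> A \<longleftrightarrow> P e"
  shows "definable L M n A"
proof -
  obtain \<phi> c where \<phi>: "wf_fm L \<phi>" "range c \<subseteq> dom M"
    "\<And>e. range e \<subseteq> dom M \<Longrightarrow> P e \<longleftrightarrow> sat M (merge e c) \<phi>"
    using P unfolding definable_pred_def by blast
  obtain a where a: "a \<in> dom M" using assms(3) by blast
  obtain K where K: "fv \<phi> \<subseteq> {..<K}"
    using finite_fv finite_nat_iff_bounded by blast
  \<comment> \<open>Even variables that do not belong to the first \<open>n\<close> coordinates become parameters too.\<close>
  define \<rho> where "\<rho> j = (if even j \<and> j div 2 < n then j div 2 else n + j)" for j
  define ps where "ps = map (merge (\<lambda>_. a) c) [0..<K]"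
  have "inj \<rho>"
    by (auto simp: inj_def \<rho>_def elim!: evenE split: if_splits)
  have ps: "length ps = K" "set ps \<subseteq> dom M"
    using \<phi>(2) a by (auto simp: ps_def merge_def)
  have fvr: "fv (rename_fm \<rho> \<phi>) \<subseteq> {..<n + length ps}"
    using K by (auto simp: fv_rename_fm[OF \<open>inj \<rho>\<close>] \<rho>_def ps)
  have "xs \<in> A \<longleftrightarrow> sat M ((!) (xs @ ps)) (rename_fm \<rho> \<phi>)" if xs: "xs \<in> tuples M n" for xs
  proof -
    define e where "e = put 0 xs (\<lambda>_. a)"
    have e: "range e \<subseteq> dom M" unfolding e_def by (rule range_put) (use xs a in auto)
    have "block e 0 n = xs"
      unfolding e_def by (rule block_put_same) (use xs in \<open>simp add: tuples_def\<close>)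
    then have "xs \<in> A \<longleftrightarrow> sat M (merge e c) \<phi>" using AP[OF e] \<phi>(3)[OF e] by simp
    also have "\<dots> \<longleftrightarrow> sat M ((!) (xs @ ps) \<circ> \<rho>) \<phi>"
    proof (rule sat_cong)
      fix i assume "i \<in> fv \<phi>"
      then have "i < K" using K by auto
      moreover have "length xs = n" using xs by (simp add: tuples_def)
      ultimately show "merge e c i = ((!) (xs @ ps) \<circ> \<rho>) i"
        by (auto simp: e_def put_def merge_def \<rho>_def nth_append ps_def)
    qed
    finally show ?thesis by (simp add: sat_rename_fm[OF \<open>inj \<rho>\<close>])
  qed
  then have "A = {xs \<in> tuples M n. sat M ((!) (xs @ ps)) (rename_fm \<rho> \<phi>)}" using A by blast
  then show ?thesis
    unfolding definable_def using wf_rename_fm[OF \<phi>(1)] ps(2) fvr by blast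
qed

lemma definable_subset_tuples: "definable L M n A \<Longrightarrow> A \<subseteq> tuples M n"
  by (auto simp: definable_def)

lemma definable_pred_block:
  fixes M :: "('f, 'r, 'a) struct"
  assumes "definable L M n A" "dom M \<noteq> {}"
  shows "definable_pred L M (\<lambda>e. block e p n \<in> A)"
proof -
  have "map (\<lambda>i. e (p + i)) [0..<n] = block e p n" for e :: "nat \<Rightarrow> 'a"
    by (auto simp: block_def intro: nth_equalityI)
  then show ?thesis
    using definable_pred_mem[OF assms, of "\<lambda>i. p + i"] by simp
qed

lemma definable_pred_block2:
  fixes M :: "('f, 'r, 'a) struct"
  assumes "definable L M (m + n) A" "dom M \<noteq> {}" "p + m \<le> q \<or> q + n \<le> p"
  shows "definable_pred L M (\<lambda>e. block e p m @ block e q n \<in> A)"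
proof -
  let ?\<sigma> = "\<lambda>i. if i < m then p + i else q + (i - m)"
  have "inj_on ?\<sigma> {..<m + n}" using assms(3) by (auto simp: inj_on_def)
  moreover have "map (\<lambda>i. e (?\<sigma> i)) [0..<m + n] = block e p m @ block e q n" for e :: "nat \<Rightarrow> 'a"
    by (auto simp: block_def nth_append intro: nth_equalityI)
  ultimately show ?thesis
    using definable_pred_mem[OF assms(1,2), of ?\<sigma>] by simp
qed

lemma definable_Int:
  assumes "dom M \<noteq> {}" "definable L M n A" "definable L M n B"
  shows "definable L M n (A \<inter> B)"
  by (rule definable_if_definable_pred[OF _ definable_pred_and[OF assms(1)
          definable_pred_block[OF assms(2,1)] definable_pred_block[OF assms(3,1)]]])
    (use definable_subset_tuples[OF assms(2)] assms(1) in auto)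

lemma definable_Diff:
  assumes "dom M \<noteq> {}" "definable L M n A" "definable L M n B"
  shows "definable L M n (A - B)"
  by (rule definable_if_definable_pred[OF _ definable_pred_and[OF assms(1)
          definable_pred_block[OF assms(2,1)]
          definable_pred_not[OF assms(1) definable_pred_block[OF assms(3,1)]]]])
    (use definable_subset_tuples[OF assms(2)] assms(1) in auto)

lemma definable_Un:
  assumes "dom M \<noteq> {}" "definable L M n A" "definable L M n B"
  shows "definable L M n (A \<union> B)"
  by (rule definable_if_definable_pred[OF _ definable_pred_not[OF assms(1) definable_pred_and[OF assms(1)
          definable_pred_not[OF assms(1) definable_pred_block[OF assms(2,1)]]
          definable_pred_not[OF assms(1) definable_pred_block[OF assms(3,1)]]]]])
    (use definable_subset_tuples[OF assms(2)] definable_subset_tuples[OF assms(3)] assms(1) in auto)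

lemma definable_relation_image:
  fixes M :: "('f, 'r, 'a) struct"
  assumes "dom M \<noteq> {}" "definable L M (m + n) \<Gamma>" "definable L M m A"
  shows "definable L M n {y \<in> tuples M n. \<exists>x\<in>A. x @ y \<in> \<Gamma>}"
proof (rule definable_if_definable_pred)
  show "definable_pred L M (\<lambda>e :: nat \<Rightarrow> 'a. \<exists>xs\<in>tuples M m. block (put n xs e) n m \<in> A \<and>
      block (put n xs e) n m @ block (put n xs e) 0 n \<in> \<Gamma>)"
    by (rule definable_pred_ex_block[OF assms(1), where P = "\<lambda>e. block e n m \<in> A \<and>
      block e n m @ block e 0 n \<in> \<Gamma>"])
      (intro definable_pred_and definable_pred_block definable_pred_block2 assms, simp)
next
  fix e :: "nat \<Rightarrow> 'a" assume e: "range e \<subseteq> dom M"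
  have eq: "block (put n xs e) n m = xs" "block (put n xs e) 0 n = block e 0 n"
    if "xs \<in> tuples M m" for xs and e :: "nat \<Rightarrow> 'a"
    using that by (simp_all add: block_put_same block_put_other tuples_def)
  show "block e 0 n \<in> {y \<in> tuples M n. \<exists>x\<in>A. x @ y \<in> \<Gamma>} \<longleftrightarrow> (\<exists>xs\<in>tuples M m.
      block (put n xs e) n m \<in> A \<and> block (put n xs e) n m @ block (put n xs e) 0 n \<in> \<Gamma>)"
    using e definable_subset_tuples[OF assms(3)] by (auto simp: eq block_in_tuples)
qed (use assms in auto)

lemma definable_relation_preimage:
  fixes M :: "('f, 'r, 'a) struct"
  assumes "dom M \<noteq> {}" "definable L M (m + n) \<Gamma>" "definable L M n B"
  shows "definable L M m {x \<in> tuples M m. \<exists>y\<in>B. x @ y \<in> \<Gamma>}"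
proof (rule definable_if_definable_pred)
  show "definable_pred L M (\<lambda>e. \<exists>ys\<in>tuples M n. block (put m ys e) m n \<in> B \<and>
      block (put m ys e) 0 m @ block (put m ys e) m n \<in> \<Gamma>)"
    by (rule definable_pred_ex_block[OF assms(1), where P = "\<lambda>e. block e m n \<in> B \<and>
      block e 0 m @ block e m n \<in> \<Gamma>"])
      (intro definable_pred_and definable_pred_block definable_pred_block2 assms, simp)
next
  fix e :: "nat \<Rightarrow> 'a" assume e: "range e \<subseteq> dom M"
  have eq: "block (put m ys e) m n = ys" "block (put m ys e) 0 m = block e 0 m"
    if "ys \<in> tuples M n" for ys and e :: "nat \<Rightarrow> 'a"
    using that by (simp_all add: block_put_same block_put_other tuples_def)
  show "block e 0 m \<in> {x \<in> tuples M m. \<exists>y\<in>B. x @ y \<in> \<Gamma>} \<longleftrightarrow> (\<exists>ys\<in>tuples M n.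
      block (put m ys e) m n \<in> B \<and> block (put m ys e) 0 m @ block (put m ys e) m n \<in> \<Gamma>)"
    using e definable_subset_tuples[OF assms(3)] by (auto simp: eq block_in_tuples)
qed (use assms in auto)

lemma definable_fiber:
  assumes "definable L M (m + n) R" "y \<in> tuples M n"
  shows "definable L M m {x \<in> tuples M m. x @ y \<in> R}"
proof -
  obtain \<phi> ps where \<phi>: "wf_fm L \<phi>" "set ps \<subseteq> dom M" "fv \<phi> \<subseteq> {..<(m + n) + length ps}"
    "R = {xs \<in> tuples M (m + n). sat M ((!) (xs @ ps)) \<phi>}"
    using assms(1) unfolding definable_def by blast
  have "x @ y \<in> R \<longleftrightarrow> sat M ((!) (x @ (y @ ps))) \<phi>" if "x \<in> tuples M m" for x
    using that assms(2) by (simp add: \<phi>(4) tuples_def)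
  then have "{x \<in> tuples M m. x @ y \<in> R} = {x \<in> tuples M m. sat M ((!) (x @ (y @ ps))) \<phi>}"
    by blast
  moreover have "set (y @ ps) \<subseteq> dom M" "fv \<phi> \<subseteq> {..<m + length (y @ ps)}"
    using \<phi> assms(2) by (auto simp: tuples_def)
  ultimately show ?thesis
    unfolding definable_def using \<phi>(1) by blast
qed

section \<open>Epsilon-nets for families of bounded VC dimension\<close>

definition shatters :: "'b set set \<Rightarrow> 'b set \<Rightarrow> bool" where
  "shatters \<F> S \<longleftrightarrow> (\<forall>T\<subseteq>S. \<exists>A\<in>\<F>. A \<inter> S = T)"

lemma shattersE:
  assumes "shatters \<F> S" "T \<subseteq> S"
  obtains A where "A \<in> \<F>" "A \<inter> S = T"
  using assms by (auto simp: shatters_def)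

lemma shatters_subset: "shatters \<F> S \<Longrightarrow> S' \<subseteq> S \<Longrightarrow> shatters \<F> S'"
  unfolding shatters_def
proof (intro allI impI)
  fix T assume "\<forall>T\<subseteq>S. \<exists>A\<in>\<F>. A \<inter> S = T" "S' \<subseteq> S" "T \<subseteq> S'"
  then obtain A where "A \<in> \<F>" "A \<inter> S = T" by (meson order_trans)
  then show "\<exists>A\<in>\<F>. A \<inter> S' = T" using \<open>S' \<subseteq> S\<close> \<open>T \<subseteq> S'\<close> by blast
qed

text \<open>Pajor's form of the Sauer--Shelah lemma.  Splitting \<open>\<F>\<close> according to membership of a point
  \<open>x\<close> gives two families on the remaining points, and a set shattered by both of them
  yields two sets shattered by \<open>\<F>\<close>, without and with \<open>x\<close>.\<close>

lemma card_le_card_shattered: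
  assumes "finite Z" "\<F> \<subseteq> Pow Z"
  shows "card \<F> \<le> card {S. S \<subseteq> Z \<and> shatters \<F> S}"
  using assms
proof (induction Z arbitrary: \<F> rule: finite_induct)
  case empty
  then have "\<F> = {} \<or> \<F> = {{}}" by auto
  then show ?case
  proof
    assume "\<F> = {{}}"
    then have "{S. S \<subseteq> {} \<and> shatters \<F> S} = {{}}" by (auto simp: shatters_def)
    then show ?thesis using \<open>\<F> = {{}}\<close> by simp
  qed simp
next
  case (insert x Z)
  define F0 F1 where "F0 = {A \<in> \<F>. x \<notin> A}" and "F1 = (\<lambda>A. A - {x}) ` {A \<in> \<F>. x \<in> A}"
  define sh where "sh \<G> = {S. S \<subseteq> Z \<and> shatters \<G> S}" for \<G>
  have fin: "finite \<F>" using insert by (meson finite_Pow_iff finite_insert finite_subset)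
  have fsh: "finite (sh \<G>)" for \<G> using insert.hyps(1) by (simp add: sh_def)
  have "inj_on (\<lambda>A. A - {x}) {A \<in> \<F>. x \<in> A}" by (auto simp: inj_on_def)
  then have "card F1 = card {A \<in> \<F>. x \<in> A}" unfolding F1_def by (rule card_image)
  moreover have "card \<F> = card F0 + card {A \<in> \<F>. x \<in> A}"
  proof -
    have "\<F> = F0 \<union> {A \<in> \<F>. x \<in> A}" by (auto simp: F0_def)
    moreover have "card (F0 \<union> {A \<in> \<F>. x \<in> A}) = card F0 + card {A \<in> \<F>. x \<in> A}"
      by (rule card_Un_disjoint) (use fin in \<open>auto simp: F0_def\<close>)
    ultimately show ?thesis by presburger
  qed
  ultimately have "card \<F> = card F0 + card F1" by simp
  also have "\<dots> \<le> card (sh F0) + card (sh F1)"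
    unfolding sh_def
    by (intro add_mono insert.IH) (use insert.prems in \<open>auto simp: F0_def F1_def\<close>)
  also have "\<dots> = card (sh F0 \<union> sh F1) + card (sh F0 \<inter> sh F1)"
    by (rule card_Un_Int) (use fsh in auto)
  also have "card (sh F0 \<inter> sh F1) = card (Set.insert x ` (sh F0 \<inter> sh F1))"
    by (rule card_image[symmetric]) (use insert.hyps(2) in \<open>auto simp: inj_on_def sh_def\<close>)
  also have "card (sh F0 \<union> sh F1) + card (Set.insert x ` (sh F0 \<inter> sh F1)) =
      card ((sh F0 \<union> sh F1) \<union> Set.insert x ` (sh F0 \<inter> sh F1))"
    by (rule card_Un_disjoint[symmetric]) (use fsh insert.hyps(2) in \<open>auto simp: sh_def\<close>)
  also have "\<dots> \<le> card {S. S \<subseteq> Set.insert x Z \<and> shatters \<F> S}"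
  proof (rule card_mono)
    have "shatters \<F> S" if "S \<in> sh F0 \<union> sh F1" for S
      unfolding shatters_def
    proof (intro allI impI)
      fix T assume T: "T \<subseteq> S"
      have xS: "x \<notin> S" using that insert.hyps(2) by (auto simp: sh_def)
      from that have "shatters F0 S \<or> shatters F1 S" by (auto simp: sh_def)
      then obtain A where "A \<in> F0 \<union> F1" "A \<inter> S = T"
        using T by (auto elim!: shattersE[OF _ T])
      then show "\<exists>A\<in>\<F>. A \<inter> S = T" using xS by (auto simp: F0_def F1_def)
    qed
    moreover have "shatters \<F> (Set.insert x S)" if "S \<in> sh F0 \<inter> sh F1" for S
      unfolding shatters_def
    proof (intro allI impI)
      fix T assume T: "T \<subseteq> Set.insert x S"
      have xS: "x \<notin> S" using that insert.hyps(2) by (auto simp: sh_def)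
      have T': "T - {x} \<subseteq> S" using T by auto
      show "\<exists>A\<in>\<F>. A \<inter> Set.insert x S = T"
      proof (cases "x \<in> T")
        case True
        have "shatters F1 S" using that by (simp add: sh_def)
        then obtain A where A: "A \<in> F1" "A \<inter> S = T - {x}" using T' by (rule shattersE)
        then obtain B where "B \<in> \<F>" "x \<in> B" "A = B - {x}" by (auto simp: F1_def)
        then show ?thesis using A True xS by (intro bexI[of _ B]) auto
      next
        case False
        have "shatters F0 S" using that by (simp add: sh_def)
        then obtain A where A: "A \<in> F0" "A \<inter> S = T - {x}" using T' by (rule shattersE)
        then show ?thesis using False by (intro bexI[of _ A]) (auto simp: F0_def)
      qed
    qed
    ultimately show "(sh F0 \<union> sh F1) \<union> Set.insert x ` (sh F0 \<inter> sh F1) \<subseteq>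
        {S. S \<subseteq> Set.insert x Z \<and> shatters \<F> S}"
      by (auto simp: sh_def)
  qed (use insert.hyps(1) in simp)
  finally show ?case .
qed

lemma card_small_subsets:
  assumes "finite Z"
  shows "card {S. S \<subseteq> Z \<and> card S \<le> k} \<le> (card Z + 1) ^ k"
proof (induction k)
  case 0
  have "{S. S \<subseteq> Z \<and> card S \<le> 0} = {{}}" using assms by (auto dest: finite_subset)
  then show ?case by simp
next
  case (Suc k)
  let ?A = "{S. S \<subseteq> Z \<and> card S \<le> k}"
  let ?f = "\<lambda>(z, S). case z of None \<Rightarrow> S | Some z \<Rightarrow> insert z S"
  have "{S. S \<subseteq> Z \<and> card S \<le> Suc k} \<subseteq> ?f ` (insert None (Some ` Z) \<times> ?A)"
  proof
    fix S assume S: "S \<in> {S. S \<subseteq> Z \<and> card S \<le> Suc k}"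
    show "S \<in> ?f ` (insert None (Some ` Z) \<times> ?A)"
    proof (cases "S = {}")
      case True
      then show ?thesis by (intro image_eqI[of _ _ "(None, {})"]) auto
    next
      case False
      then obtain z where z: "z \<in> S" by blast
      have "finite S" using S assms finite_subset by blast
      then have "card (S - {z}) \<le> k" using S z by (auto simp: card_Diff_singleton)
      moreover have "S = ?f (Some z, S - {z})" using z by auto
      ultimately show ?thesis
        using S z by (intro image_eqI[of _ ?f "(Some z, S - {z})"]) auto
    qed
  qed
  then have "card {S. S \<subseteq> Z \<and> card S \<le> Suc k} \<le> card (insert None (Some ` Z) \<times> ?A)"
    using assms by (intro surj_card_le) auto
  also have "\<dots> = (card Z + 1) * card ?A"
    using assms by (simp add: card_cartesian_product card_image image_iff)
  also have "\<dots> \<le> (card Z + 1) * (card Z + 1) ^ k"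
    by (rule mult_le_mono2[OF Suc.IH])
  finally show ?case by simp
qed

lemma sauer_shelah:
  assumes "finite Z" "\<F> \<subseteq> Pow Z" "\<And>S. S \<subseteq> Z \<Longrightarrow> card S = k \<Longrightarrow> \<not> shatters \<F> S"
  shows "card \<F> \<le> (card Z + 1) ^ k"
proof -
  have "card S \<le> k" if S: "S \<subseteq> Z" "shatters \<F> S" for S
  proof (rule ccontr)
    assume "\<not> card S \<le> k"
    then obtain S' where "S' \<subseteq> S" "card S' = k"
      using obtain_subset_with_card_n[of k S] by auto
    then show False using assms(3)[of S'] S shatters_subset by blast
  qed
  then have "{S. S \<subseteq> Z \<and> shatters \<F> S} \<subseteq> {S. S \<subseteq> Z \<and> card S \<le> k}" by auto
  then have "card {S. S \<subseteq> Z \<and> shatters \<F> S} \<le> card {S. S \<subseteq> Z \<and> card S \<le> k}"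
    using assms(1) by (intro card_mono) auto
  with card_le_card_shattered[OF assms(1,2)]
  have "card \<F> \<le> card {S. S \<subseteq> Z \<and> card S \<le> k}" by (rule order_trans)
  then show ?thesis using card_small_subsets[OF assms(1)] by (rule order_trans)
qed

definition swap_fst :: "nat set \<Rightarrow> (nat \<Rightarrow> 'b) \<Rightarrow> (nat \<Rightarrow> 'b) \<Rightarrow> nat \<Rightarrow> 'b" where
  "swap_fst \<sigma> u v = (\<lambda>i. if i \<in> \<sigma> then v i else u i)"

text \<open>Of all ways to exchange corresponding entries of a pair of samples, at most a fraction
  \<open>2 ^ - r\<close> makes a given set \<open>F\<close> miss the first sample and meet the second in \<open>r\<close> places:
  every position at which \<open>F\<close> meets the pair has a forced orientation.\<close>

lemma card_swaps_one_sided: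
  fixes u v :: "nat \<Rightarrow> 'b"
  shows "card {\<sigma>. \<sigma> \<subseteq> {..<n} \<and> (\<forall>i<n. swap_fst \<sigma> u v i \<notin> F) \<and>
      r \<le> card {i. i < n \<and> swap_fst \<sigma> v u i \<in> F}} * 2 ^ r \<le> 2 ^ n"
    (is "card ?G * _ \<le> _")
proof (cases "?G = {}")
  case False
  define I where "I = {i. i < n \<and> (u i \<in> F \<or> v i \<in> F)}"
  have IG: "\<sigma> \<inter> I = {i. i < n \<and> u i \<in> F}" if "\<sigma> \<in> ?G" for \<sigma>
  proof -
    have miss: "\<forall>i<n. swap_fst \<sigma> u v i \<notin> F" using that by blast
    have "v i \<notin> F" if "i < n" "i \<in> \<sigma>" for i using that miss by (metis swap_fst_def)
    moreover have "u i \<notin> F" if "i < n" "i \<notin> \<sigma>" for i using that miss by (metis swap_fst_def)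
    ultimately show ?thesis unfolding I_def by blast
  qed
  from False obtain \<sigma> where \<sigma>: "\<sigma> \<in> ?G" by blast
  have "card {i. i < n \<and> swap_fst \<sigma> v u i \<in> F} \<le> card I"
    by (rule card_mono) (auto simp: I_def swap_fst_def split: if_splits)
  then have rI: "r \<le> card I" using \<sigma> by auto
  have In: "I \<subseteq> {..<n}" "finite I" by (auto simp: I_def)
  have "inj_on (\<lambda>\<sigma>. \<sigma> - I) ?G"
  proof (rule inj_onI)
    fix \<sigma> \<tau> assume "\<sigma> \<in> ?G" "\<tau> \<in> ?G" "\<sigma> - I = \<tau> - I"
    moreover have "\<sigma> \<inter> I = \<tau> \<inter> I" using IG \<open>\<sigma> \<in> ?G\<close> \<open>\<tau> \<in> ?G\<close> by simp
    ultimately show "\<sigma> = \<tau>" by blast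
  qed
  then have "card ?G \<le> card (Pow ({..<n} - I))"
    by (rule card_inj_on_le) auto
  also have "\<dots> = 2 ^ (n - card I)"
    using In by (simp add: card_Pow card_Diff_subset)
  finally have "card ?G * 2 ^ r \<le> 2 ^ (n - card I) * 2 ^ card I"
    using rI by (intro mult_mono power_increasing) auto
  also have "\<dots> = 2 ^ n"
    using card_mono[OF _ In(1)] by (simp flip: power_add)
  finally show ?thesis .
next
  case True
  show ?thesis unfolding True by simp
qed

text \<open>Suppose that every sample of \<open>4 * r\<close> points is missed by some set of the family.  Draw two
  independent random samples.  A set \<open>F\<close> that misses the first one meets the second in at least
  \<open>r\<close> places with probability at least \<open>1 / 3\<close>, by Markov's inequality.  On the other hand,
  exchanging the two samples in a random set of positions does not change their distribution, and
  for each of the at most \<open>(8 * r + 1) ^ k\<close> traces of the family on the sampled points a random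
  exchange leads to this situation with probability at most \<open>2 ^ - r\<close>.\<close>

lemma eps_net_finite:
  fixes w :: "'b \<Rightarrow> real"
  assumes finP: "finite P" and w0: "\<And>p. p \<in> P \<Longrightarrow> 0 \<le> w p" and w1: "sum w P = 1"
    and fam: "\<F> \<subseteq> Pow P" and half: "\<And>F. F \<in> \<F> \<Longrightarrow> 1 / 2 \<le> sum w F"
    and vc: "\<And>S. S \<subseteq> P \<Longrightarrow> card S = k \<Longrightarrow> \<not> shatters \<F> S"
    and r: "3 * (8 * r + 1) ^ k < (2 :: nat) ^ r"
  shows "\<exists>u\<in>{..<4 * r} \<rightarrow>\<^sub>E P. \<forall>F\<in>\<F>. \<exists>i<4 * r. u i \<in> F"
proof (rule ccontr)
  define n where "n = 4 * r"
  define U where "U = {..<n} \<rightarrow>\<^sub>E P"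
  define W where "W u = (\<Prod>i<n. w (u i))" for u
  define E where "E u v \<longleftrightarrow> (\<exists>F\<in>\<F>. (\<forall>i<n. u i \<notin> F) \<and> r \<le> card {i. i < n \<and> v i \<in> F})" for u v
  assume "\<not> ?thesis"
  then have "\<forall>u\<in>U. \<exists>F\<in>\<F>. \<forall>i<n. u i \<notin> F" by (auto simp: U_def n_def)
  then obtain FF where FF: "\<And>u. u \<in> U \<Longrightarrow> FF u \<in> \<F>" "\<And>u i. u \<in> U \<Longrightarrow> i < n \<Longrightarrow> u i \<notin> FF u"
    by metis
  have r0: "0 < r" using r by (cases r) auto
  have finU: "finite U" unfolding U_def using finP by (intro finite_PiE) auto
  have UP: "u i \<in> P" if "u \<in> U" "i < n" for u i using that by (auto simp: U_def)
  have W0: "0 \<le> W u" if "u \<in> U" for u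
    unfolding W_def using that UP w0 by (intro prod_nonneg) auto
  have W1: "sum W U = 1"
    unfolding U_def W_def using finP w1 by (subst prod_sum_PiE[symmetric]) auto
  have marginal: "(\<Sum>v\<in>U. W v * of_bool (v i \<notin> F)) = 1 - sum w F" if i: "i < n" and F: "F \<subseteq> P" for i F
  proof -
    have "(\<Sum>v\<in>U. W v * of_bool (v i \<notin> F)) =
        (\<Sum>v\<in>U. \<Prod>j<n. w (v j) * (if j = i then of_bool (v j \<notin> F) else 1))"
      using i by (intro sum.cong) (auto simp: W_def prod.distrib)
    also have "\<dots> = (\<Prod>j<n. \<Sum>p\<in>P. w p * (if j = i then of_bool (p \<notin> F) else 1))"
      unfolding U_def using finP
      by (subst prod_sum_PiE[where f = "\<lambda>j p. w p * (if j = i then of_bool (p \<notin> F) else 1)"]) auto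
    also have "\<dots> = (\<Prod>j<n. if j = i then \<Sum>p\<in>P. w p * of_bool (p \<notin> F) else 1)"
      by (intro prod.cong) (auto simp: w1)
    also have "\<dots> = (\<Sum>p\<in>P. w p * of_bool (p \<notin> F))" using i by simp
    also have "\<dots> = (\<Sum>p\<in>P - F. w p)"
      using finP by (intro sum.mono_neutral_cong_right) auto
    also have "\<dots> = 1 - sum w F"
      using sum_diff[OF finP F, of w] w1 by simp
    finally show ?thesis .
  qed
  have lower: "1 / 3 \<le> (\<Sum>v\<in>U. W v * of_bool (E u v))" if u: "u \<in> U" for u
  proof -
    let ?F = "FF u"
    have FP: "?F \<subseteq> P" using FF(1)[OF u] fam by blast
    have bound: "1 - (\<Sum>i<n. of_bool (v i \<notin> ?F)) / (3 * real r) \<le> of_bool (E u v)" for v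
    proof (cases "E u v")
      case True
      then show ?thesis using r0 by (simp add: sum_nonneg)
    next
      case False
      then have "card {i. i < n \<and> v i \<in> ?F} < r" using FF u unfolding E_def by (meson not_le)
      moreover have "(\<Sum>i<n. of_bool (v i \<notin> ?F)) + real (card {i. i < n \<and> v i \<in> ?F}) = real n"
      proof -
        have "real (card {i. i < n \<and> v i \<in> ?F}) = (\<Sum>i<n. of_bool (v i \<in> ?F))"
          by (simp add: sum_of_bool_eq Int_def conj_commute lessThan_def)
        moreover have "(\<Sum>i<n. of_bool (v i \<notin> ?F)) + (\<Sum>i<n. of_bool (v i \<in> ?F)) = (\<Sum>i<n. 1 :: real)"
          unfolding sum.distrib[symmetric] by (intro sum.cong) auto
        ultimately show ?thesis by simp
      qed
      ultimately have "3 * real r \<le> (\<Sum>i<n. of_bool (v i \<notin> ?F))" by (simp add: n_def)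
      then show ?thesis using r0 False by (simp add: field_simps)
    qed
    have "(\<Sum>v\<in>U. W v * (1 - (\<Sum>i<n. of_bool (v i \<notin> ?F)) / (3 * real r))) =
        1 - (\<Sum>v\<in>U. \<Sum>i<n. W v * of_bool (v i \<notin> ?F)) / (3 * real r)"
      by (simp add: right_diff_distrib sum_subtractf W1 sum_divide_distrib sum_distrib_left mult.commute)
    also have "(\<Sum>v\<in>U. \<Sum>i<n. W v * of_bool (v i \<notin> ?F)) = (\<Sum>i<n. 1 - sum w ?F)"
      unfolding sum.swap[of _ "{..<n}"] by (intro sum.cong) (auto simp: marginal FP)
    also have "\<dots> = real n * (1 - sum w ?F)" by simp
    finally have "(\<Sum>v\<in>U. W v * (1 - (\<Sum>i<n. of_bool (v i \<notin> ?F)) / (3 * real r))) =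
        1 - real n * (1 - sum w ?F) / (3 * real r)" .
    moreover have "\<dots> \<ge> 1 / 3"
      using half[OF FF(1)[OF u]] r0 by (simp add: n_def field_simps)
    moreover have "(\<Sum>v\<in>U. W v * (1 - (\<Sum>i<n. of_bool (v i \<notin> ?F)) / (3 * real r))) \<le>
        (\<Sum>v\<in>U. W v * of_bool (E u v))"
      by (intro sum_mono mult_left_mono bound W0)
    ultimately show ?thesis by linarith
  qed
  define total where "total = (\<Sum>(u, v)\<in>U \<times> U. W u * W v * of_bool (E u v))"
  have "1 / 3 = (\<Sum>u\<in>U. W u * (1 / 3))" by (simp add: W1 flip: sum_divide_distrib)
  also have "\<dots> \<le> (\<Sum>u\<in>U. W u * (\<Sum>v\<in>U. W v * of_bool (E u v)))"
    by (intro sum_mono mult_left_mono lower W0)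
  also have "\<dots> = total"
    unfolding total_def by (simp add: sum.cartesian_product sum_distrib_left mult.assoc)
  finally have total_lower: "1 / 3 \<le> total" .
  have swapU: "swap_fst \<sigma> u v \<in> U" if "\<sigma> \<subseteq> {..<n}" "u \<in> U" "v \<in> U" for \<sigma> u v
    using that by (auto simp: U_def swap_fst_def PiE_iff extensional_def)
  have swapW: "W (swap_fst \<sigma> u v) * W (swap_fst \<sigma> v u) = W u * W v" for \<sigma> u v
    unfolding W_def prod.distrib[symmetric] by (intro prod.cong) (auto simp: swap_fst_def)
  have swap2: "swap_fst \<sigma> (swap_fst \<sigma> u v) (swap_fst \<sigma> v u) = u" for \<sigma> and u v :: "nat \<Rightarrow> 'b"
    by (auto simp: swap_fst_def)
  have invariant: "total = (\<Sum>(u, v)\<in>U \<times> U. W u * W v * of_bool (E (swap_fst \<sigma> u v) (swap_fst \<sigma> v u)))"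
    if \<sigma>: "\<sigma> \<subseteq> {..<n}" for \<sigma>
    unfolding total_def
    by (rule sum.reindex_bij_witness[where
          i = "\<lambda>(u, v). (swap_fst \<sigma> u v, swap_fst \<sigma> v u)" and
          j = "\<lambda>(u, v). (swap_fst \<sigma> u v, swap_fst \<sigma> v u)"])
      (auto simp: swap2 swapU[OF \<sigma>] swapW)
  have few: "card {\<sigma>. \<sigma> \<subseteq> {..<n} \<and> E (swap_fst \<sigma> u v) (swap_fst \<sigma> v u)} * 2 ^ r \<le>
      (8 * r + 1) ^ k * 2 ^ n" if uv: "u \<in> U" "v \<in> U" for u v
  proof -
    define Z where "Z = u ` {..<n} \<union> v ` {..<n}"
    define TR where "TR = (\<lambda>F. F \<inter> Z) ` \<F>"
    define G where "G F = {\<sigma>. \<sigma> \<subseteq> {..<n} \<and> (\<forall>i<n. swap_fst \<sigma> u v i \<notin> F) \<and>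
        r \<le> card {i. i < n \<and> swap_fst \<sigma> v u i \<in> F}}" for F
    have finZ: "finite Z" and ZP: "Z \<subseteq> P" using uv UP by (auto simp: Z_def)
    have cardZ: "card Z \<le> 8 * r"
    proof -
      have "card Z \<le> card (u ` {..<n}) + card (v ` {..<n})" unfolding Z_def by (rule card_Un_le)
      also have "\<dots> \<le> n + n" using card_image_le[of "{..<n}"] by (intro add_mono) auto
      finally show ?thesis by (simp add: n_def)
    qed
    have "card TR \<le> (card Z + 1) ^ k"
    proof (rule sauer_shelah[OF finZ])
      fix S assume S: "S \<subseteq> Z" "card S = k"
      show "\<not> shatters TR S"
      proof
        assume sh: "shatters TR S"
        have "\<exists>A\<in>\<F>. A \<inter> S = T" if T: "T \<subseteq> S" for T
        proof -
          obtain A where "A \<in> TR" "A \<inter> S = T" using sh T by (rule shattersE)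
          then show ?thesis using S by (auto simp: TR_def Int_assoc Int_absorb1)
        qed
        then have "shatters \<F> S" by (simp add: shatters_def)
        then show False using vc[of S] S ZP by blast
      qed
    qed (auto simp: TR_def)
    also have "\<dots> \<le> (8 * r + 1) ^ k" using cardZ by (intro power_mono) auto
    finally have cTR: "card TR \<le> (8 * r + 1) ^ k" .
    have finTR: "finite TR"
      by (rule finite_subset[of _ "Pow Z"]) (use finZ in \<open>auto simp: TR_def\<close>)
    have "{\<sigma>. \<sigma> \<subseteq> {..<n} \<and> E (swap_fst \<sigma> u v) (swap_fst \<sigma> v u)} \<subseteq> (\<Union>t\<in>TR. G t)"
    proof
      fix \<sigma> assume "\<sigma> \<in> {\<sigma>. \<sigma> \<subseteq> {..<n} \<and> E (swap_fst \<sigma> u v) (swap_fst \<sigma> v u)}"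
      then obtain F where F: "F \<in> \<F>" "\<sigma> \<in> G F" by (auto simp: E_def G_def)
      have "swap_fst \<sigma> u v i \<in> Z" "swap_fst \<sigma> v u i \<in> Z" if "i < n" for i
        using that by (auto simp: swap_fst_def Z_def)
      then have "{i. i < n \<and> swap_fst \<sigma> v u i \<in> F \<inter> Z} = {i. i < n \<and> swap_fst \<sigma> v u i \<in> F}" by blast
      then have "\<sigma> \<in> G (F \<inter> Z)" using F(2) unfolding G_def by auto
      then show "\<sigma> \<in> (\<Union>t\<in>TR. G t)" using F(1) by (auto simp: TR_def)
    qed
    moreover have "finite (G t)" for t
      by (rule finite_subset[of _ "Pow {..<n}"]) (auto simp: G_def)
    ultimately have "card {\<sigma>. \<sigma> \<subseteq> {..<n} \<and> E (swap_fst \<sigma> u v) (swap_fst \<sigma> v u)} \<le> card (\<Union>t\<in>TR. G t)"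
      using finTR by (intro card_mono) auto
    also have "\<dots> \<le> (\<Sum>t\<in>TR. card (G t))" using finTR by (rule card_UN_le)
    finally have "card {\<sigma>. \<sigma> \<subseteq> {..<n} \<and> E (swap_fst \<sigma> u v) (swap_fst \<sigma> v u)} * 2 ^ r \<le>
        (\<Sum>t\<in>TR. card (G t) * 2 ^ r)" by (simp flip: sum_distrib_right)
    also have "\<dots> \<le> (\<Sum>t\<in>TR. 2 ^ n)"
      unfolding G_def by (intro sum_mono card_swaps_one_sided)
    also have "\<dots> = card TR * 2 ^ n" by simp
    also have "\<dots> \<le> (8 * r + 1) ^ k * 2 ^ n" using cTR by (rule mult_le_mono1)
    finally show ?thesis .
  qed
  have "2 ^ n * total = (\<Sum>\<sigma>\<in>Pow {..<n}. total)" by (simp add: card_Pow)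
  also have "\<dots> = (\<Sum>\<sigma>\<in>Pow {..<n}. \<Sum>(u, v)\<in>U \<times> U.
      W u * W v * of_bool (E (swap_fst \<sigma> u v) (swap_fst \<sigma> v u)))"
    by (intro sum.cong refl invariant) auto
  also have "\<dots> = (\<Sum>(u, v)\<in>U \<times> U. W u * W v *
      real (card {\<sigma>. \<sigma> \<subseteq> {..<n} \<and> E (swap_fst \<sigma> u v) (swap_fst \<sigma> v u)}))"
    unfolding sum.swap[of _ "U \<times> U"]
    by (intro sum.cong refl) (auto simp: sum_of_bool_eq Int_def simp flip: sum_distrib_left)
  finally have "2 ^ n * total * 2 ^ r = (\<Sum>(u, v)\<in>U \<times> U. W u * W v *
      real (card {\<sigma>. \<sigma> \<subseteq> {..<n} \<and> E (swap_fst \<sigma> u v) (swap_fst \<sigma> v u)} * 2 ^ r))"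
    by (simp add: sum_distrib_right case_prod_unfold mult.assoc)
  also have "\<dots> \<le> (\<Sum>(u, v)\<in>U \<times> U. W u * W v * real ((8 * r + 1) ^ k * 2 ^ n))"
  proof (rule sum_mono)
    fix p assume "p \<in> U \<times> U"
    then obtain u v where p: "p = (u, v)" "u \<in> U" "v \<in> U" by blast
    have "real (card {\<sigma>. \<sigma> \<subseteq> {..<n} \<and> E (swap_fst \<sigma> u v) (swap_fst \<sigma> v u)} * 2 ^ r) \<le>
        real ((8 * r + 1) ^ k * 2 ^ n)"
      using few[OF p(2,3)] by (simp only: of_nat_le_iff)
    then have "W u * W v * real (card {\<sigma>. \<sigma> \<subseteq> {..<n} \<and> E (swap_fst \<sigma> u v) (swap_fst \<sigma> v u)} * 2 ^ r) \<le>
        W u * W v * real ((8 * r + 1) ^ k * 2 ^ n)"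
      by (rule mult_left_mono) (simp add: W0 p)
    then show "(case p of (u, v) \<Rightarrow> W u * W v *
        real (card {\<sigma>. \<sigma> \<subseteq> {..<n} \<and> E (swap_fst \<sigma> u v) (swap_fst \<sigma> v u)} * 2 ^ r)) \<le>
      (case p of (u, v) \<Rightarrow> W u * W v * real ((8 * r + 1) ^ k * 2 ^ n))"
      by (simp only: p(1) prod.case)
  qed
  also have "\<dots> = (\<Sum>(u, v)\<in>U \<times> U. W u * W v) * real ((8 * r + 1) ^ k * 2 ^ n)"
    by (simp only: sum_distrib_right case_prod_unfold)
  also have "(\<Sum>(u, v)\<in>U \<times> U. W u * W v) = 1"
    by (simp add: W1 flip: sum.cartesian_product sum_distrib_left sum_distrib_right)
  finally have "total * 2 ^ r \<le> real ((8 * r + 1) ^ k)" by simp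
  moreover have "3 * real ((8 * r + 1) ^ k) < 2 ^ r"
    using r by (metis of_nat_less_iff of_nat_mult of_nat_numeral of_nat_power)
  moreover have "(1 / 3) * 2 ^ r \<le> total * 2 ^ r" using total_lower by (intro mult_right_mono) auto
  ultimately show False by linarith
qed

text \<open>A finite subfamily generates finitely many atoms, so that a finitely additive
  measure restricts to a measure on a finite set of representatives of these.\<close>

lemma eps_net:
  fixes \<mu> :: "'b set \<Rightarrow> real"
  assumes alg: "algebra \<Omega> \<A>" and add: "additive \<A> \<mu>"
    and \<mu>0: "\<And>A. A \<in> \<A> \<Longrightarrow> 0 \<le> \<mu> A" and \<mu>1: "\<mu> \<Omega> = 1"
    and fin: "finite \<F>" and fam: "\<F> \<subseteq> \<A>" and half: "\<And>F. F \<in> \<F> \<Longrightarrow> 1 / 2 \<le> \<mu> F"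
    and vc: "\<And>S. S \<subseteq> \<Omega> \<Longrightarrow> finite S \<Longrightarrow> card S = k \<Longrightarrow> \<not> shatters \<F> S"
    and r: "3 * (8 * r + 1) ^ k < (2 :: nat) ^ r"
  shows "\<exists>u\<in>{..<4 * r} \<rightarrow>\<^sub>E \<Omega>. \<forall>F\<in>\<F>. \<exists>i<4 * r. u i \<in> F"
proof -
  interpret algebra \<Omega> \<A> by fact
  define tr where "tr x = {F \<in> \<F>. x \<in> F}" for x
  define P where "P = inv_into \<Omega> tr ` tr ` \<Omega>"
  define atom where "atom p = {y \<in> \<Omega>. tr y = tr p}" for p
  have finP: "finite P"
    unfolding P_def by (intro finite_imageI finite_subset[of "tr ` \<Omega>" "Pow \<F>"]) (auto simp: tr_def fin)
  have P\<Omega>: "P \<subseteq> \<Omega>" unfolding P_def by (auto intro: inv_into_into)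
  have Pinj: "p = q" if "p \<in> P" "q \<in> P" "tr p = tr q" for p q
    using that by (auto simp: P_def f_inv_into_f)
  have rep: "\<exists>p\<in>P. tr p = tr x" if "x \<in> \<Omega>" for x
    using that by (auto simp: P_def f_inv_into_f intro!: bexI[of _ "inv_into \<Omega> tr (tr x)"])
  have atomA: "atom p \<in> \<A>" if "p \<in> \<Omega>" for p
  proof -
    have "atom p = \<Omega> - (\<Union>F\<in>\<F>. if p \<in> F then \<Omega> - F else F)"
      unfolding atom_def tr_def by (auto split: if_splits)
    moreover have "(\<Union>F\<in>\<F>. if p \<in> F then \<Omega> - F else F) \<in> \<A>"
      using fin fam by (intro finite_UN) auto
    ultimately show ?thesis by auto
  qed
  define w where "w p = \<mu> (atom p)" for p
  have \<mu>_empty: "\<mu> {} = 0"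
    using additiveD[OF add, of "{}" "{}"] by simp
  have sum_atoms: "sum w Q = \<mu> (\<Union>p\<in>Q. atom p)" if "Q \<subseteq> P" for Q
    using finite_subset[OF that finP] that
  proof (induction Q)
    case empty
    then show ?case by (simp add: \<mu>_empty)
  next
    case (insert q Q)
    have "\<mu> (atom q \<union> (\<Union>p\<in>Q. atom p)) = \<mu> (atom q) + \<mu> (\<Union>p\<in>Q. atom p)"
    proof (rule additiveD[OF add])
      show "atom q \<inter> (\<Union>p\<in>Q. atom p) = {}"
        using insert Pinj unfolding atom_def by fastforce
      show "(\<Union>p\<in>Q. atom p) \<in> \<A>"
        using insert P\<Omega> atomA by (intro finite_UN) auto
    qed (use insert P\<Omega> atomA in auto)
    then show ?case using insert by (simp add: w_def)
  qed
  have atomsF: "(\<Union>p\<in>F \<inter> P. atom p) = F" if "F \<in> \<F>" for F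
  proof -
    have F\<Omega>: "F \<subseteq> \<Omega>" using that fam sets_into_space by blast
    have cong: "x \<in> F" if "tr x = tr y" "y \<in> F" for x y
      using that \<open>F \<in> \<F>\<close> unfolding tr_def by blast
    show ?thesis
    proof
      show "(\<Union>p\<in>F \<inter> P. atom p) \<subseteq> F" using cong by (auto simp: atom_def)
      show "F \<subseteq> (\<Union>p\<in>F \<inter> P. atom p)"
      proof
        fix x assume x: "x \<in> F"
        then obtain p where p: "p \<in> P" "tr p = tr x" using rep F\<Omega> by blast
        then have "p \<in> F" using x cong by blast
        then show "x \<in> (\<Union>p\<in>F \<inter> P. atom p)" using p x F\<Omega> by (auto simp: atom_def)
      qed
    qed
  qed
  have "\<exists>u\<in>{..<4 * r} \<rightarrow>\<^sub>E P. \<forall>F\<in>(\<lambda>F. F \<inter> P) ` \<F>. \<exists>i<4 * r. u i \<in> F"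
  proof (rule eps_net_finite[where w = w and k = k])
    show "0 \<le> w p" if "p \<in> P" for p using that P\<Omega> atomA \<mu>0 by (auto simp: w_def)
    have "(\<Union>p\<in>P. atom p) = \<Omega>"
    proof
      show "\<Omega> \<subseteq> (\<Union>p\<in>P. atom p)"
      proof
        fix x assume x: "x \<in> \<Omega>"
        then obtain p where "p \<in> P" "tr p = tr x" using rep by blast
        then show "x \<in> (\<Union>p\<in>P. atom p)" using x by (auto simp: atom_def)
      qed
    qed (auto simp: atom_def)
    then show "sum w P = 1" using sum_atoms[of P] \<mu>1 by simp
    show "1 / 2 \<le> sum w F" if "F \<in> (\<lambda>F. F \<inter> P) ` \<F>" for F
      using that sum_atoms atomsF half by auto
    show "\<not> shatters ((\<lambda>F. F \<inter> P) ` \<F>) S" if S: "S \<subseteq> P" "card S = k" for S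
    proof
      assume sh: "shatters ((\<lambda>F. F \<inter> P) ` \<F>) S"
      have "\<exists>A\<in>\<F>. A \<inter> S = T" if T: "T \<subseteq> S" for T
      proof -
        obtain A where "A \<in> (\<lambda>F. F \<inter> P) ` \<F>" "A \<inter> S = T" using sh T by (rule shattersE)
        then show ?thesis using S by (auto simp: Int_assoc Int_absorb1)
      qed
      then have "shatters \<F> S" by (simp add: shatters_def)
      then show False using vc[of S] S P\<Omega> finite_subset[OF S(1) finP] by blast
    qed
  qed (use finP r in auto)
  then obtain u where u: "u \<in> {..<4 * r} \<rightarrow>\<^sub>E P"
    and hit: "\<forall>F\<in>(\<lambda>F. F \<inter> P) ` \<F>. \<exists>i<4 * r. u i \<in> F" by blast
  have "\<forall>F\<in>\<F>. \<exists>i<4 * r. u i \<in> F" using hit by fastforce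
  moreover have "u \<in> {..<4 * r} \<rightarrow>\<^sub>E \<Omega>" using u P\<Omega> by (auto simp: PiE_iff)
  ultimately show ?thesis by blast
qed

lemma ex_sample_size: "\<exists>r :: nat. 3 * (8 * r + 1) ^ k < (2 :: nat) ^ r"
proof -
  have "\<forall>\<^sub>F r in sequentially. 3 * (8 * real r + 1) ^ k < 2 ^ r" by real_asymp
  then obtain r where "3 * (8 * real r + 1) ^ k < 2 ^ r"
    unfolding eventually_sequentially by blast
  then have "real (3 * (8 * r + 1) ^ k) < real (2 ^ r)"
    by (simp only: of_nat_mult of_nat_power of_nat_add of_nat_numeral of_nat_1)
  then show ?thesis unfolding of_nat_less_iff by blast
qed

section \<open>Proximal flows\<close>

lemma flowD:
  assumes "flow H X \<alpha>"
  shows "group H" and "topspace X \<noteq> {}" and "compact_space X" and "Hausdorff_space X"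
    and "\<And>h x. h \<in> carrier H \<Longrightarrow> x \<in> topspace X \<Longrightarrow> \<alpha> h x \<in> topspace X"
    and "\<And>x. x \<in> topspace X \<Longrightarrow> \<alpha> \<one>\<^bsub>H\<^esub> x = x"
    and "\<And>g h x. g \<in> carrier H \<Longrightarrow> h \<in> carrier H \<Longrightarrow> x \<in> topspace X \<Longrightarrow>
          \<alpha> (g \<otimes>\<^bsub>H\<^esub> h) x = \<alpha> g (\<alpha> h x)"
    and "\<And>h. h \<in> carrier H \<Longrightarrow> \<alpha> h \<in> extensional (topspace X)"
    and "\<And>h. h \<in> carrier H \<Longrightarrow> continuous_map X X (\<alpha> h)"
proof -
  have act: "group_action H (topspace X) \<alpha>" using assms by (simp add: flow_def)
  note a = group_action_act[OF act]
  show "group H" by (rule a)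
  show "\<alpha> h x \<in> topspace X" if "h \<in> carrier H" "x \<in> topspace X" for h x using that by (rule a)
  show "\<alpha> \<one>\<^bsub>H\<^esub> x = x" if "x \<in> topspace X" for x using that by (rule a)
  show "\<alpha> (g \<otimes>\<^bsub>H\<^esub> h) x = \<alpha> g (\<alpha> h x)"
    if "g \<in> carrier H" "h \<in> carrier H" "x \<in> topspace X" for g h x using that by (rule a)
  show "\<alpha> h \<in> extensional (topspace X)" if "h \<in> carrier H" for h using that by (rule a)
  show "topspace X \<noteq> {}" "compact_space X" "Hausdorff_space X" using assms unfolding flow_def by auto
  show "continuous_map X X (\<alpha> h)" if "h \<in> carrier H" for h
    using assms that unfolding flow_def by (blast intro: homeomorphic_imp_continuous_map)
qed

lemma proximal_flowE:
  assumes "proximal_flow H X \<alpha>" "x \<in> topspace X" "y \<in> topspace X"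
  obtains z where "z \<in> topspace X"
    "\<And>U. openin X U \<Longrightarrow> z \<in> U \<Longrightarrow> \<exists>h\<in>carrier H. \<alpha> h x \<in> U \<and> \<alpha> h y \<in> U"
proof -
  from assms obtain F z where F: "F \<noteq> bot" "\<forall>\<^sub>F h in F. h \<in> carrier H"
    "limitin X (\<lambda>h. \<alpha> h x) z F" "limitin X (\<lambda>h. \<alpha> h y) z F"
    unfolding proximal_flow_def by blast
  show thesis
  proof (rule that)
    show "z \<in> topspace X" using F(3) by (simp add: limitin_def)
    fix U assume "openin X U" "z \<in> U"
    then have "\<forall>\<^sub>F h in F. \<alpha> h x \<in> U" "\<forall>\<^sub>F h in F. \<alpha> h y \<in> U"
      using F(3,4) by (simp_all add: limitin_def)
    with F(2) have "\<forall>\<^sub>F h in F. h \<in> carrier H \<and> \<alpha> h x \<in> U \<and> \<alpha> h y \<in> U"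
      by eventually_elim simp
    then show "\<exists>h\<in>carrier H. \<alpha> h x \<in> U \<and> \<alpha> h y \<in> U"
      using eventually_happens'[OF F(1)] by blast
  qed
qed

text \<open>By compactness, a net that contracts \<open>W\<close> to \<open>z\<close> can be refined so that it moves a further
  point \<open>w\<close> towards some \<open>y\<close>; a second contraction then brings \<open>z\<close> and \<open>y\<close> together.\<close>

lemma proximal_contracts_finite:
  assumes prox: "proximal_flow H X \<alpha>" and "finite W" "W \<subseteq> topspace X"
  shows "\<exists>z\<in>topspace X. \<forall>U. openin X U \<longrightarrow> z \<in> U \<longrightarrow> (\<exists>h\<in>carrier H. \<alpha> h ` W \<subseteq> U)"
  using assms(2,3)
proof (induction W)
  case empty
  have fl: "flow H X \<alpha>" using prox by (simp add: proximal_flow_def)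
  then interpret H: group H by (rule flowD)
  show ?case using flowD(2)[OF fl] H.one_closed by blast
next
  case (insert w W)
  have fl: "flow H X \<alpha>" using prox by (simp add: proximal_flow_def)
  interpret H: group H by (rule flowD[OF fl])
  note f = flowD[OF fl]
  obtain z where z: "z \<in> topspace X"
    "\<And>U. openin X U \<Longrightarrow> z \<in> U \<Longrightarrow> \<exists>h\<in>carrier H. \<alpha> h ` W \<subseteq> U"
    using insert by auto
  have w: "w \<in> topspace X" and WX: "W \<subseteq> topspace X" using insert.prems by auto
  define orb where "orb U = (\<lambda>h. \<alpha> h w) ` {h \<in> carrier H. \<alpha> h ` W \<subseteq> U}" for U
  define \<N> where "\<N> = {U. openin X U \<and> z \<in> U}"
  have "\<Inter>((\<lambda>U. X closure_of orb U) ` \<N>) \<noteq> {}"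
  proof (rule compact_space_fip[THEN iffD1, OF f(3), rule_format], intro conjI allI impI ballI)
    fix \<F> assume "finite \<F> \<and> \<F> \<subseteq> (\<lambda>U. X closure_of orb U) ` \<N>"
    then obtain \<V> where \<V>: "\<V> \<subseteq> \<N>" "finite \<V>" "\<F> = (\<lambda>U. X closure_of orb U) ` \<V>"
      using finite_subset_image by meson
    have "openin X (\<Inter>(Set.insert (topspace X) \<V>))"
      by (rule openin_Inter) (use \<V> in \<open>auto simp: \<N>_def\<close>)
    moreover have "z \<in> \<Inter>(Set.insert (topspace X) \<V>)" using \<V>(1) z(1) by (auto simp: \<N>_def)
    ultimately obtain h where h: "h \<in> carrier H" "\<alpha> h ` W \<subseteq> \<Inter>(Set.insert (topspace X) \<V>)"
      using z(2) by metis
    have "\<alpha> h w \<in> X closure_of orb U" if "U \<in> \<V>" for U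
    proof -
      have "orb U \<subseteq> topspace X" using f(5) w by (auto simp: orb_def)
      then have "orb U \<subseteq> X closure_of orb U" by (rule closure_of_subset)
      moreover have "\<alpha> h w \<in> orb U" using h that by (auto simp: orb_def)
      ultimately show ?thesis by blast
    qed
    then show "\<Inter>\<F> \<noteq> {}" using \<V>(3) by auto
  qed auto
  then obtain y where y: "\<And>U. openin X U \<Longrightarrow> z \<in> U \<Longrightarrow> y \<in> X closure_of orb U"
    by (auto simp: \<N>_def)
  have yX: "y \<in> topspace X" using y[OF openin_topspace z(1)] by (simp add: in_closure_of)
  obtain t where t: "t \<in> topspace X"
    "\<And>U. openin X U \<Longrightarrow> t \<in> U \<Longrightarrow> \<exists>h\<in>carrier H. \<alpha> h z \<in> U \<and> \<alpha> h y \<in> U"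
    using proximal_flowE[OF prox z(1) yX] by metis
  show ?case
  proof (intro bexI[OF _ t(1)] allI impI)
    fix U assume U: "openin X U" "t \<in> U"
    then obtain h where h: "h \<in> carrier H" "\<alpha> h z \<in> U" "\<alpha> h y \<in> U" using t(2) by blast
    define U' where "U' = {x \<in> topspace X. \<alpha> h x \<in> U}"
    have U': "openin X U'"
      unfolding U'_def using f(9)[OF h(1)] U(1) by (rule openin_continuous_map_preimage)
    moreover have "z \<in> U'" "y \<in> U'" using h z(1) yX by (auto simp: U'_def)
    ultimately have "\<exists>x\<in>orb U'. x \<in> U'" using y[of U'] by (auto simp: in_closure_of)
    then obtain h' where h': "h' \<in> carrier H" "\<alpha> h' ` W \<subseteq> U'" "\<alpha> h' w \<in> U'" by (auto simp: orb_def)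
    have "\<alpha> (h \<otimes>\<^bsub>H\<^esub> h') x \<in> U" if "x \<in> Set.insert w W" for x
    proof -
      have "\<alpha> h' x \<in> U'" "x \<in> topspace X" using that h' w WX by auto
      then show ?thesis using f(7)[OF h(1) h'(1)] by (simp add: U'_def)
    qed
    then show "\<exists>h\<in>carrier H. \<alpha> h ` Set.insert w W \<subseteq> U"
      using h(1) h'(1) by (intro bexI[of _ "h \<otimes>\<^bsub>H\<^esub> h'"]) auto
  qed
qed

text \<open>If \<open>h x\<close> and \<open>h (f x) = f (h x)\<close> both tend to \<open>z\<close>, then \<open>f z = z\<close> by continuity; the fixed
  points of \<open>f\<close> form a subflow.\<close>

lemma minimal_proximal_endomorphism:
  assumes min: "minimal_flow H X \<alpha>" and prox: "proximal_flow H X \<alpha>"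
    and f: "flow_map H X \<alpha> X \<alpha> f" and "x \<in> topspace X"
  shows "f x = x"
proof -
  have fl: "flow H X \<alpha>" using prox by (simp add: proximal_flow_def)
  note a = flowD[OF fl]
  have cf: "continuous_map X X f" and eqv: "\<And>h x. h \<in> carrier H \<Longrightarrow> x \<in> topspace X \<Longrightarrow> f (\<alpha> h x) = \<alpha> h (f x)"
    using f by (auto simp: flow_map_def)
  have fX: "f x \<in> topspace X" if "x \<in> topspace X" for x
    using cf that by (auto simp: continuous_map_def)
  obtain z where z: "z \<in> topspace X"
    "\<And>U. openin X U \<Longrightarrow> z \<in> U \<Longrightarrow> \<exists>h\<in>carrier H. \<alpha> h x \<in> U \<and> \<alpha> h (f x) \<in> U"
    using proximal_flowE[OF prox assms(4) fX[OF assms(4)]] by metis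
  have "f z = z"
  proof (rule ccontr)
    assume "f z \<noteq> z"
    then obtain U V where UV: "openin X U" "openin X V" "z \<in> U" "f z \<in> V" "disjnt U V"
      using a(4) z(1) fX[OF z(1)] unfolding Hausdorff_space_def by metis
    have "openin X (U \<inter> {x \<in> topspace X. f x \<in> V})"
      using UV cf by (intro openin_Int openin_continuous_map_preimage)
    then obtain h where "h \<in> carrier H" "\<alpha> h x \<in> U \<inter> {x \<in> topspace X. f x \<in> V}" "\<alpha> h (f x) \<in> U"
      using z(2)[of "U \<inter> {x \<in> topspace X. f x \<in> V}"] UV z(1) by auto
    then show False using eqv assms(4) UV(5) by (auto simp: disjnt_iff)
  qed
  moreover have "subflow H X \<alpha> {x \<in> topspace X. f x = id x}"
    unfolding subflow_def using closedin_continuous_maps_eq[OF a(4) cf continuous_map_id] a(5) eqv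
    by auto
  ultimately have "{x \<in> topspace X. f x = id x} = topspace X"
    using min z(1) unfolding minimal_flow_def by (metis (mono_tags, lifting) empty_iff id_apply mem_Collect_eq)
  then show ?thesis using assms(4) by auto
qed

text \<open>Both composites are endomorphisms, hence identities.\<close>

lemma minimal_proximal_isomorphic:
  assumes X: "minimal_flow H X \<alpha>" "proximal_flow H X \<alpha>"
    and Y: "minimal_flow H Y \<beta>" "proximal_flow H Y \<beta>"
    and f: "flow_map H X \<alpha> Y \<beta> f" and k: "flow_map H Y \<beta> X \<alpha> k"
  shows "isomorphic_flows H X \<alpha> Y \<beta>"
proof -
  have comp: "flow_map H A a C c (q \<circ> p)"
    if p: "flow_map H A a B b p" and q: "flow_map H B b C c q"
    for A a C c p q and B :: "'k topology" and b
  proof -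
    have "p x \<in> topspace B" if "x \<in> topspace A" for x
      using p that by (auto simp: flow_map_def continuous_map_def)
    then show ?thesis
      using p q by (auto simp: flow_map_def intro: continuous_map_compose)
  qed
  have "k (f x) = x" if "x \<in> topspace X" for x
    using minimal_proximal_endomorphism[OF X comp[OF f k] that] by simp
  moreover have "f (k y) = y" if "y \<in> topspace Y" for y
    using minimal_proximal_endomorphism[OF Y comp[OF k f] that] by simp
  ultimately have "homeomorphic_maps X Y f k"
    using f k by (simp add: homeomorphic_maps_def flow_map_def)
  then have "homeomorphic_map X Y f" using homeomorphic_map_maps by blast
  then show ?thesis using f unfolding isomorphic_flows_def by blast
qed

text \<open>A separating set may contain either of the two preimages; passing to the complement in the
  group decides which.\<close>

lemma definable_flow_separation:
  assumes "definable_flow L M n H X \<alpha>" "dom M \<noteq> {}" "definable L M n (carrier H)"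
    and "x \<in> topspace X" "closedin X C" "openin X U" "C \<subseteq> U"
  obtains B where "definable_subset L M n H B"
    "\<And>h. h \<in> carrier H \<Longrightarrow> \<alpha> h x \<in> C \<Longrightarrow> h \<notin> B"
    "\<And>h. h \<in> carrier H \<Longrightarrow> h \<notin> B \<Longrightarrow> \<alpha> h x \<in> U"
proof -
  have fl: "flow H X \<alpha>" using assms(1) by (simp add: definable_flow_def)
  have "closedin X (topspace X - U)" "C \<inter> (topspace X - U) = {}" using assms(6,7) by auto
  then obtain A where A: "definable_subset L M n H A"
    "separates A {h \<in> carrier H. \<alpha> h x \<in> C} {h \<in> carrier H. \<alpha> h x \<in> topspace X - U}"
    using assms(1,4,5) unfolding definable_flow_def by meson
  have xX: "\<alpha> h x \<in> topspace X" if "h \<in> carrier H" for h using flowD(5)[OF fl that assms(4)] .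
  have cA: "definable_subset L M n H (carrier H - A)"
    using A(1) definable_Diff[OF assms(2,3)] by (auto simp: definable_subset_def)
  from A(2) show thesis
    unfolding separates_def
  proof
    assume "{h \<in> carrier H. \<alpha> h x \<in> C} \<subseteq> A \<and> A \<inter> {h \<in> carrier H. \<alpha> h x \<in> topspace X - U} = {}"
    then show thesis using xX by (intro that[OF cA]) auto
  next
    assume "{h \<in> carrier H. \<alpha> h x \<in> topspace X - U} \<subseteq> A \<and> A \<inter> {h \<in> carrier H. \<alpha> h x \<in> C} = {}"
    then show thesis using xX by (intro that[OF A(1)]) auto
  qed
qed

section \<open>Definably amenable normal subgroups act trivially\<close>

text \<open>NIP speaks about formulas without parameters; the parameters of \<open>R\<close> are absorbed into the
  second group of variables.\<close>

lemma nip_not_shatters: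
  fixes M :: "('f, 'r, 'a) struct"
  assumes nip: "\<And>\<phi> n. wf_fm L \<phi> \<Longrightarrow> fv \<phi> \<subseteq> {..<m + n} \<Longrightarrow> nip_formula M m n \<phi>"
    and R: "definable L M (m + n) R"
  shows "\<exists>k. \<forall>S. S \<subseteq> tuples M m \<longrightarrow> finite S \<longrightarrow> card S = k \<longrightarrow>
    \<not> shatters ((\<lambda>y. {x \<in> tuples M m. x @ y \<in> R}) ` tuples M n) S"
proof -
  obtain \<phi> ps where \<phi>: "wf_fm L \<phi>" "set ps \<subseteq> dom M" "fv \<phi> \<subseteq> {..<(m + n) + length ps}"
    "R = {xs \<in> tuples M (m + n). sat M ((!) (xs @ ps)) \<phi>}"
    using R unfolding definable_def by blast
  have "nip_formula M m (n + length ps) \<phi>"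
    using \<phi>(3) by (intro nip[OF \<phi>(1)]) (simp add: add.assoc)
  then obtain k where k: "\<not> (\<exists>(a :: nat \<Rightarrow> 'a list) (b :: nat set \<Rightarrow> 'a list).
      (\<forall>i<k. a i \<in> tuples M m) \<and> (\<forall>J\<subseteq>{..<k}. b J \<in> tuples M (n + length ps)) \<and>
      (\<forall>i<k. \<forall>J\<subseteq>{..<k}. sat M ((!) (a i @ b J)) \<phi> \<longleftrightarrow> i \<in> J))"
    unfolding nip_formula_def ..
  have "\<not> shatters ((\<lambda>y. {x \<in> tuples M m. x @ y \<in> R}) ` tuples M n) S"
    if S: "S \<subseteq> tuples M m" "finite S" "card S = k" for S
  proof
    assume sh: "shatters ((\<lambda>y. {x \<in> tuples M m. x @ y \<in> R}) ` tuples M n) S"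
    obtain a where a: "bij_betw a {..<k} S"
      using ex_bij_betw_nat_finite[OF S(2)] S(3) by (auto simp: atLeast0LessThan)
    have aS: "a i \<in> S" if "i < k" for i using a that by (auto simp: bij_betw_def)
    have "\<exists>y\<in>tuples M n. \<forall>i<k. a i @ y \<in> R \<longleftrightarrow> i \<in> J" if J: "J \<subseteq> {..<k}" for J
    proof -
      have "a ` J \<subseteq> S" using J aS by auto
      with sh obtain A where "A \<in> (\<lambda>y. {x \<in> tuples M m. x @ y \<in> R}) ` tuples M n" "A \<inter> S = a ` J"
        by (rule shattersE)
      then obtain y where y: "y \<in> tuples M n" "{x \<in> tuples M m. x @ y \<in> R} \<inter> S = a ` J" by blast
      have "a i @ y \<in> R \<longleftrightarrow> i \<in> J" if i: "i < k" for i
      proof -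
        have "a i @ y \<in> R \<longleftrightarrow> a i \<in> a ` J" using y(2) aS[OF i] S(1) by blast
        also have "\<dots> \<longleftrightarrow> i \<in> J"
          using a J i by (auto simp: bij_betw_def dest: inj_onD)
        finally show ?thesis .
      qed
      then show ?thesis using y(1) by blast
    qed
    then obtain Y where Y: "\<And>J. J \<subseteq> {..<k} \<Longrightarrow> Y J \<in> tuples M n"
      "\<And>J i. J \<subseteq> {..<k} \<Longrightarrow> i < k \<Longrightarrow> a i @ Y J \<in> R \<longleftrightarrow> i \<in> J" by metis
    have "\<exists>(a :: nat \<Rightarrow> 'a list) (b :: nat set \<Rightarrow> 'a list).
      (\<forall>i<k. a i \<in> tuples M m) \<and> (\<forall>J\<subseteq>{..<k}. b J \<in> tuples M (n + length ps)) \<and>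
      (\<forall>i<k. \<forall>J\<subseteq>{..<k}. sat M ((!) (a i @ b J)) \<phi> \<longleftrightarrow> i \<in> J)"
    proof (rule exI[of _ a], rule exI[of _ "\<lambda>J. Y J @ ps"], intro conjI)
      show "\<forall>i<k. a i \<in> tuples M m" using aS S(1) by blast
      show "\<forall>J\<subseteq>{..<k}. Y J @ ps \<in> tuples M (n + length ps)"
        using Y(1) \<phi>(2) by (auto simp: tuples_def)
      show "\<forall>i<k. \<forall>J\<subseteq>{..<k}. sat M ((!) (a i @ Y J @ ps)) \<phi> \<longleftrightarrow> i \<in> J"
      proof (intro allI impI)
        fix i J assume iJ: "i < k" "J \<subseteq> {..<k}"
        have "a i @ Y J \<in> tuples M (m + n)"
          using aS[OF iJ(1)] S(1) Y(1)[OF iJ(2)] by (auto simp: tuples_def)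
        then show "sat M ((!) (a i @ Y J @ ps)) \<phi> \<longleftrightarrow> i \<in> J"
          using Y(2)[OF iJ(2,1)] by (simp add: \<phi>(4))
      qed
    qed
    with k show False by contradiction
  qed
  then show ?thesis by blast
qed

text \<open>The preimages in \<open>D\<close> of the translates of a definable set are the fibres of a single definable
  relation between \<open>D\<close> and \<open>G\<close>; it is expressed by quantifying over the values \<open>w = \<iota> x\<close> and
  \<open>v = y w\<close>.\<close>

lemma definable_translate_relation:
  fixes M :: "('f, 'r, 'a) struct"
  assumes M: "dom M \<noteq> {}" and D: "definable_group L M d D" and G: "definable_group L M g G"
    and \<iota>: "definable_hom L M d D g G \<iota>" and B: "definable L M g B"
  shows "definable L M (d + g) {x @ y | x y. x \<in> carrier D \<and> y \<in> carrier G \<and> y \<otimes>\<^bsub>G\<^esub> \<iota> x \<in> B}"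
    (is "definable L M _ ?R")
proof -
  define \<Gamma> where "\<Gamma> = {x @ \<iota> x | x. x \<in> carrier D}"
  define \<Delta> where "\<Delta> = {x @ y @ (x \<otimes>\<^bsub>G\<^esub> y) | x y. x \<in> carrier G \<and> y \<in> carrier G}"
  have def\<Gamma>: "definable L M (d + g) \<Gamma>" and def\<Delta>: "definable L M (g + g + g) \<Delta>"
    using \<iota> G by (auto simp: definable_hom_def definable_group_def \<Gamma>_def \<Delta>_def)
  have DT: "carrier D \<subseteq> tuples M d" and GT: "carrier G \<subseteq> tuples M g"
    using D G unfolding definable_group_def by (blast dest: definable_subset_tuples)+
  have \<iota>G: "\<iota> x \<in> carrier G" if "x \<in> carrier D" for x
    using that \<iota> by (auto simp: definable_hom_def hom_def)
  interpret G: group G using G by (simp add: definable_group_def)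
  let ?P = "\<lambda>e :: nat \<Rightarrow> 'a. (block e 0 d @ block e (d + g) g \<in> \<Gamma> \<and> block e d (g + g + g) \<in> \<Delta>) \<and>
      block e (d + g + g) g \<in> B"
  have "definable_pred L M ?P"
    by (intro definable_pred_and definable_pred_block definable_pred_block2 def\<Gamma> def\<Delta> B M) simp
  then have P: "definable_pred L M (\<lambda>e. \<exists>w\<in>tuples M g. \<exists>v\<in>tuples M g.
      ?P (put (d + g + g) v (put (d + g) w e)))"
    by (rule definable_pred_ex_block[OF M definable_pred_ex_block[OF M]])
  have split: "block e 0 (d + g) = block e 0 d @ block e d g"
    "block e d (g + g + g) = block e d g @ block e (d + g) g @ block e (d + g + g) g" for e :: "nat \<Rightarrow> 'a"
    using block_add[of e 0 d g] block_add[of e d "g + g" g] block_add[of e d g g]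
    by (simp_all add: add.assoc)
  have len: "length x = d" if "x \<in> carrier D" for x using DT that by (auto simp: tuples_def)
  have lenG: "length x = g" if "x \<in> carrier G" for x using GT that by (auto simp: tuples_def)
  have lenb: "length (block e p n) = n" for e :: "nat \<Rightarrow> 'a" and p n by (simp add: block_def)
  show ?thesis
  proof (rule definable_if_definable_pred[OF _ P M])
    show "?R \<subseteq> tuples M (d + g)" using DT GT by (fastforce simp: tuples_def)
    fix e :: "nat \<Rightarrow> 'a" assume e: "range e \<subseteq> dom M"
    let ?x = "block e 0 d" and ?y = "block e d g"
    have R: "block e 0 (d + g) \<in> ?R \<longleftrightarrow> ?x \<in> carrier D \<and> ?y \<in> carrier G \<and> ?y \<otimes>\<^bsub>G\<^esub> \<iota> ?x \<in> B"
      unfolding split using len lenG lenb by (auto simp: append_eq_append_conv)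
    have put: "?P (put (d + g + g) v (put (d + g) w e)) \<longleftrightarrow> ?x @ w \<in> \<Gamma> \<and> ?y @ w @ v \<in> \<Delta> \<and> v \<in> B"
      if "w \<in> tuples M g" "v \<in> tuples M g" for w v
      using that by (simp add: split block_put_same block_put_other tuples_def)
    have \<Gamma>: "?x @ w \<in> \<Gamma> \<longleftrightarrow> ?x \<in> carrier D \<and> w = \<iota> ?x" for w
      using len lenb unfolding \<Gamma>_def by (auto simp: append_eq_append_conv)
    have \<Delta>: "?y @ w @ v \<in> \<Delta> \<longleftrightarrow> ?y \<in> carrier G \<and> w \<in> carrier G \<and> v = ?y \<otimes>\<^bsub>G\<^esub> w"
      if "length w = g" for w v
    proof
      assume "?y @ w @ v \<in> \<Delta>"
      then obtain a b where ab: "?y @ w @ v = a @ b @ (a \<otimes>\<^bsub>G\<^esub> b)" "a \<in> carrier G" "b \<in> carrier G"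
        unfolding \<Delta>_def by blast
      then have "?y = a \<and> w = b \<and> v = a \<otimes>\<^bsub>G\<^esub> b"
        using that lenG[of a] lenG[of b] lenb[of e d g] by simp
      then show "?y \<in> carrier G \<and> w \<in> carrier G \<and> v = ?y \<otimes>\<^bsub>G\<^esub> w" using ab by simp
    qed (auto simp: \<Delta>_def)
    show "block e 0 (d + g) \<in> ?R \<longleftrightarrow> (\<exists>w\<in>tuples M g. \<exists>v\<in>tuples M g.
        ?P (put (d + g + g) v (put (d + g) w e)))" (is "_ \<longleftrightarrow> ?E")
    proof
      assume "block e 0 (d + g) \<in> ?R"
      then have *: "?x \<in> carrier D" "?y \<in> carrier G" "?y \<otimes>\<^bsub>G\<^esub> \<iota> ?x \<in> B" using R by auto
      have c: "\<iota> ?x \<in> carrier G" "?y \<otimes>\<^bsub>G\<^esub> \<iota> ?x \<in> carrier G" using * \<iota>G by auto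
      then have t: "\<iota> ?x \<in> tuples M g" "?y \<otimes>\<^bsub>G\<^esub> \<iota> ?x \<in> tuples M g" using GT by auto
      have "?P (put (d + g + g) (?y \<otimes>\<^bsub>G\<^esub> \<iota> ?x) (put (d + g) (\<iota> ?x) e))"
        unfolding put[OF t] using * c by (simp add: \<Gamma> \<Delta> lenG)
      then show ?E using t by blast
    next
      assume ?E
      then obtain w v where t: "w \<in> tuples M g" "v \<in> tuples M g"
        and P: "?P (put (d + g + g) v (put (d + g) w e))" by blast
      have "length w = g" using t(1) by (simp add: tuples_def)
      with P[unfolded put[OF t]] show "block e 0 (d + g) \<in> ?R" unfolding R by (auto simp: \<Gamma> \<Delta>)
    qed
  qed
qed

lemma definable_translate:
  assumes M: "dom M \<noteq> {}" and D: "definable_group L M d D" and G: "definable_group L M g G"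
    and \<iota>: "definable_hom L M d D g G \<iota>" and B: "definable L M g B"
  shows "\<exists>R. definable L M (d + g) R \<and>
    (\<forall>h\<in>carrier G. {x \<in> carrier D. h \<otimes>\<^bsub>G\<^esub> \<iota> x \<in> B} = {x \<in> tuples M d. x @ h \<in> R})"
proof (intro exI conjI ballI)
  let ?R = "{x @ y | x y. x \<in> carrier D \<and> y \<in> carrier G \<and> y \<otimes>\<^bsub>G\<^esub> \<iota> x \<in> B}"
  show "definable L M (d + g) ?R" using assms by (rule definable_translate_relation)
  fix h assume h: "h \<in> carrier G"
  have DT: "carrier D \<subseteq> tuples M d"
    using D unfolding definable_group_def by (blast dest: definable_subset_tuples)
  have "x @ h \<in> ?R \<longleftrightarrow> x \<in> carrier D \<and> h \<otimes>\<^bsub>G\<^esub> \<iota> x \<in> B" if x: "x \<in> tuples M d" for x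
  proof
    assume "x @ h \<in> ?R"
    then obtain x' y where xy: "x @ h = x' @ y" "x' \<in> carrier D" "y \<in> carrier G" "y \<otimes>\<^bsub>G\<^esub> \<iota> x' \<in> B" by blast
    moreover have "length x = length x'" using x xy(2) DT by (auto simp: tuples_def)
    ultimately show "x \<in> carrier D \<and> h \<otimes>\<^bsub>G\<^esub> \<iota> x \<in> B" by simp
  qed (use h in blast)
  then show "{x \<in> carrier D. h \<otimes>\<^bsub>G\<^esub> \<iota> x \<in> B} = {x \<in> tuples M d. x @ h \<in> ?R}" using DT by blast
qed

lemma definable_subsets_algebra:
  assumes M: "dom M \<noteq> {}" and D: "definable L M d (carrier D)"
  shows "algebra (carrier D) {A. definable_subset L M d D A}"
  unfolding algebra_iff_Un
proof (intro conjI ballI)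
  show "{} \<in> {A. definable_subset L M d D A}"
    using definable_Diff[OF M D D] by (simp add: definable_subset_def)
  fix A assume A: "A \<in> {A. definable_subset L M d D A}"
  then show "carrier D - A \<in> {A. definable_subset L M d D A}"
    using definable_Diff[OF M D] by (simp add: definable_subset_def)
  fix A' assume "A' \<in> {A. definable_subset L M d D A}"
  with A show "A \<union> A' \<in> {A. definable_subset L M d D A}"
    using definable_Un[OF M] by (simp add: definable_subset_def)
qed (auto simp: definable_subset_def)

text \<open>The sets \<open>{x. h \<iota>(x) \<in> B}\<close> form a family of finite VC dimension, and so those of measure
  at least \<open>1 / 2\<close> among finitely many of them are met by boundedly many points of \<open>D\<close>.  All of them
  at once need not be met by finitely many points of \<open>D\<close>; but the number of points is bounded, so
  that compactness of a power of \<open>X\<close> provides limit points in the flow that do the same job.\<close>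

lemma finite_net_in_flow:
  fixes M :: "('f, 'r, 'a) struct" and \<mu> :: "'a list set \<Rightarrow> real"
  assumes M: "dom M \<noteq> {}"
    and nip: "\<And>\<phi> n. wf_fm L \<phi> \<Longrightarrow> fv \<phi> \<subseteq> {..<d + n} \<Longrightarrow> nip_formula M d n \<phi>"
    and D: "definable_group L M d D" and G: "definable_group L M g G"
    and \<iota>: "definable_hom L M d D g G \<iota>"
    and \<mu>0: "\<And>A. definable_subset L M d D A \<Longrightarrow> 0 \<le> \<mu> A" and \<mu>1: "\<mu> (carrier D) = 1"
    and add: "\<And>A B. definable_subset L M d D A \<Longrightarrow> definable_subset L M d D B \<Longrightarrow> A \<inter> B = {} \<Longrightarrow>
      \<mu> (A \<union> B) = \<mu> A + \<mu> B"
    and fl: "flow G X \<alpha>" and x0: "x0 \<in> topspace X" and V: "openin X V"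
    and B: "definable_subset L M g G B"
    and disj: "\<And>h. h \<in> carrier G \<Longrightarrow> \<alpha> h x0 \<in> V \<Longrightarrow> h \<notin> B"
  obtains W where "finite W" "W \<subseteq> topspace X"
    "\<And>h. h \<in> carrier G \<Longrightarrow> \<alpha> h ` W \<subseteq> V \<Longrightarrow> \<mu> {x \<in> carrier D. h \<otimes>\<^bsub>G\<^esub> \<iota> x \<in> B} < 1 / 2"
proof -
  note f = flowD[OF fl]
  interpret G: group G by (rule f)
  have \<iota>G: "\<iota> x \<in> carrier G" if "x \<in> carrier D" for x
    using that \<iota> by (auto simp: definable_hom_def hom_def)
  have GT: "carrier G \<subseteq> tuples M g"
    using G unfolding definable_group_def by (blast dest: definable_subset_tuples)
  have DT: "carrier D \<subseteq> tuples M d" and defD: "definable L M d (carrier D)"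
    using D unfolding definable_group_def by (blast dest: definable_subset_tuples)+
  define F where "F h = {x \<in> carrier D. h \<otimes>\<^bsub>G\<^esub> \<iota> x \<in> B}" for h
  have defB: "definable L M g B" using B by (simp add: definable_subset_def)
  obtain R where R: "definable L M (d + g) R"
    "\<And>h. h \<in> carrier G \<Longrightarrow> F h = {x \<in> tuples M d. x @ h \<in> R}"
    unfolding F_def using definable_translate[OF M D G \<iota> defB] by blast
  have defF: "definable_subset L M d D (F h)" if "h \<in> carrier G" for h
  proof -
    have "definable L M d (F h)"
      unfolding R(2)[OF that] using GT that by (intro definable_fiber[OF R(1)]) auto
    then show ?thesis by (auto simp: definable_subset_def F_def)
  qed
  have "\<exists>k. \<forall>S. S \<subseteq> tuples M d \<longrightarrow> finite S \<longrightarrow> card S = k \<longrightarrow>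
      \<not> shatters ((\<lambda>y. {x \<in> tuples M d. x @ y \<in> R}) ` tuples M g) S"
    by (rule nip_not_shatters[OF _ R(1)]) (rule nip)
  then obtain k where k: "\<forall>S. S \<subseteq> tuples M d \<longrightarrow> finite S \<longrightarrow> card S = k \<longrightarrow>
      \<not> shatters ((\<lambda>y. {x \<in> tuples M d. x @ y \<in> R}) ` tuples M g) S" ..
  obtain r where r: "3 * (8 * r + 1) ^ k < (2 :: nat) ^ r" using ex_sample_size by blast
  define n where "n = 4 * r"
  define Big where "Big = {h \<in> carrier G. 1 / 2 \<le> \<mu> (F h)}"
  have net: "\<exists>u\<in>{..<n} \<rightarrow>\<^sub>E carrier D. \<forall>h\<in>\<H>. \<exists>i<n. u i \<in> F h"
    if \<H>: "finite \<H>" "\<H> \<subseteq> Big" for \<H>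
  proof -
    have HG: "\<H> \<subseteq> carrier G" using \<H>(2) by (auto simp: Big_def)
    have "\<exists>u\<in>{..<4 * r} \<rightarrow>\<^sub>E carrier D. \<forall>A\<in>F ` \<H>. \<exists>i<4 * r. u i \<in> A"
    proof (rule eps_net[where \<mu> = \<mu> and k = k, OF definable_subsets_algebra[OF M defD] _ _ \<mu>1 _ _ _ _ r])
      show "additive {A. definable_subset L M d D A} \<mu>" using add by (simp add: additive_def)
      show "F ` \<H> \<subseteq> {A. definable_subset L M d D A}" using defF HG by auto
      show "1 / 2 \<le> \<mu> A" if "A \<in> F ` \<H>" for A using that \<H>(2) by (auto simp: Big_def)
      show "\<not> shatters (F ` \<H>) S" if S: "S \<subseteq> carrier D" "finite S" "card S = k" for S
      proof
        assume sh: "shatters (F ` \<H>) S"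
        have "F ` \<H> \<subseteq> (\<lambda>y. {x \<in> tuples M d. x @ y \<in> R}) ` tuples M g"
          using HG GT R(2) by blast
        with sh have "shatters ((\<lambda>y. {x \<in> tuples M d. x @ y \<in> R}) ` tuples M g) S"
          unfolding shatters_def by (meson subsetD)
        moreover have "S \<subseteq> tuples M d" using S(1) DT by (rule order_trans)
        ultimately show False using k S(2,3) by blast
      qed
    qed (use \<mu>0 \<H>(1) in auto)
    then show ?thesis by (simp add: n_def)
  qed
  \<comment> \<open>\<open>K h\<close> consists of the \<open>n\<close>-tuples in \<open>X\<close> that are a net for the single set \<open>F h\<close>.\<close>
  define Z where "Z = product_topology (\<lambda>_. X) {..<n}"
  have topZ: "topspace Z = {..<n} \<rightarrow>\<^sub>E topspace X" by (simp add: Z_def)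
  have compZ: "compact_space Z"
    unfolding Z_def using f(3) by (simp add: compact_space_product_topology)
  define K where "K h = {u \<in> topspace Z. \<exists>i<n. \<alpha> h (u i) \<notin> V}" for h
  have closedK: "closedin Z (K h)" if h: "h \<in> carrier G" for h
  proof -
    have "closedin Z {u \<in> topspace Z. \<alpha> h (u i) \<in> topspace X - V}" if i: "i < n" for i
    proof (rule closedin_continuous_map_preimage[where Y = X])
      have "continuous_map Z X (\<lambda>u. u i)"
        unfolding Z_def using i by (intro continuous_map_product_projection) auto
      then have "continuous_map Z X (\<alpha> h \<circ> (\<lambda>u. u i))"
        using f(9)[OF h] by (rule continuous_map_compose)
      then show "continuous_map Z X (\<lambda>u. \<alpha> h (u i))" by (simp add: comp_def)
    qed (use V in auto)
    then have "closedin Z (\<Union>i\<in>{..<n}. {u \<in> topspace Z. \<alpha> h (u i) \<in> topspace X - V})"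
      by (intro closedin_Union) auto
    moreover have "K h = (\<Union>i\<in>{..<n}. {u \<in> topspace Z. \<alpha> h (u i) \<in> topspace X - V})"
      unfolding K_def using f(5)[OF h] by (auto simp: topZ PiE_iff)
    ultimately show ?thesis by simp
  qed
  have "\<Inter>(Set.insert (topspace Z) (K ` Big)) \<noteq> {}"
  proof (rule compact_space_fip[THEN iffD1, OF compZ, rule_format], intro conjI allI impI ballI)
    fix C assume "C \<in> Set.insert (topspace Z) (K ` Big)"
    then show "closedin Z C" using closedK by (auto simp: Big_def)
  next
    fix \<F> assume F: "finite \<F> \<and> \<F> \<subseteq> Set.insert (topspace Z) (K ` Big)"
    then have "finite (\<F> - {topspace Z})" "\<F> - {topspace Z} \<subseteq> K ` Big" by auto
    then obtain \<H> where \<H>: "\<H> \<subseteq> Big" "finite \<H>" "\<F> - {topspace Z} = K ` \<H>"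
      by (meson finite_subset_image)
    obtain u where u: "u \<in> {..<n} \<rightarrow>\<^sub>E carrier D" "\<forall>h\<in>\<H>. \<exists>i<n. u i \<in> F h"
      using net[OF \<H>(2,1)] by (elim bexE)
    define p where "p = (\<lambda>i\<in>{..<n}. \<alpha> (\<iota> (u i)) x0)"
    have pZ: "p \<in> topspace Z"
      using u(1) \<iota>G f(5) x0 by (auto simp: topZ p_def PiE_iff)
    have "p \<in> K h" if h: "h \<in> \<H>" for h
    proof -
      obtain i where i: "i < n" "u i \<in> F h" using bspec[OF u(2) h] by blast
      have hG: "h \<in> carrier G" using h \<H>(1) by (auto simp: Big_def)
      have ui: "u i \<in> carrier D" "h \<otimes>\<^bsub>G\<^esub> \<iota> (u i) \<in> B" using i(2) by (auto simp: F_def)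
      then have "\<alpha> (h \<otimes>\<^bsub>G\<^esub> \<iota> (u i)) x0 \<notin> V" using disj hG \<iota>G by blast
      then have "\<alpha> h (p i) \<notin> V" using f(7)[OF hG \<iota>G[OF ui(1)] x0] i(1) by (simp add: p_def)
      then show ?thesis using pZ i(1) by (auto simp: K_def)
    qed
    then have "p \<in> \<Inter>\<F>" using \<H>(3) pZ by blast
    then show "\<Inter>\<F> \<noteq> {}" by blast
  qed
  then obtain u where u: "u \<in> topspace Z" "\<And>h. h \<in> Big \<Longrightarrow> u \<in> K h" by auto
  show thesis
  proof (rule that[of "u ` {..<n}"])
    show "u ` {..<n} \<subseteq> topspace X" using u(1) by (auto simp: topZ PiE_iff)
    fix h assume h: "h \<in> carrier G" "\<alpha> h ` u ` {..<n} \<subseteq> V"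
    then have "u \<notin> K h" by (auto simp: K_def)
    then have "h \<notin> Big" using u(2) by blast
    then show "\<mu> {x \<in> carrier D. h \<otimes>\<^bsub>G\<^esub> \<iota> x \<in> B} < 1 / 2"
      using h(1) by (simp add: Big_def F_def not_le)
  qed simp
qed

text \<open>If \<open>D\<close> acted nontrivially, then by minimality no point would be fixed by \<open>D\<close>, and \<open>X\<close>
  would be covered by finitely many open sets \<open>V\<close>, each with a larger open set \<open>U\<close> around it that
  is moved off itself by some \<open>c \<in> D\<close>.  Contracting the nets of all these sets at once, some
  \<open>h \<in> G\<close> moves the net belonging to \<open>V\<close> into \<open>V\<close>, so that for more than half of all \<open>d \<in> D\<close> the
  point \<open>h d x0\<close> lies in \<open>U\<close>.  By normality \<open>c h = h e\<close> for some
  \<open>e \<in> D\<close>, so that by invariance the same is true of \<open>c h d x0 = h e d x0\<close>, and both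
  must hold for some common \<open>d\<close>.\<close>

lemma definably_amenable_kernel_acts_trivially:
  fixes M :: "('f, 'r, 'a) struct"
  assumes M: "dom M \<noteq> {}"
    and nip: "\<And>\<phi> n. wf_fm L \<phi> \<Longrightarrow> fv \<phi> \<subseteq> {..<d + n} \<Longrightarrow> nip_formula M d n \<phi>"
    and exact: "definable_exact_sequence L M d D \<iota> g G \<pi> s S"
    and amenable: "definably_amenable L M d D"
    and X: "minimal_proximal_definable_flow L M g G X \<alpha>"
    and c: "c \<in> carrier D" and x: "x \<in> topspace X"
  shows "\<alpha> (\<iota> c) x = x"
proof (rule ccontr)
  assume moved: "\<alpha> (\<iota> c) x \<noteq> x"
  have D: "definable_group L M d D" and G: "definable_group L M g G" and S: "definable_group L M s S"
    and \<iota>: "definable_hom L M d D g G \<iota>" and \<pi>: "definable_hom L M g G s S \<pi>"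
    and ker: "\<iota> ` carrier D = kernel G S \<pi>"
    using exact by (auto simp: definable_exact_sequence_def)
  have dfl: "definable_flow L M g G X \<alpha>" and min: "minimal_flow G X \<alpha>" and prox: "proximal_flow G X \<alpha>"
    using X by (auto simp: minimal_proximal_definable_flow_def)
  have fl: "flow G X \<alpha>" using dfl by (simp add: definable_flow_def)
  note f = flowD[OF fl]
  interpret D: group D using D by (simp add: definable_group_def)
  interpret G: group G by (rule f)
  interpret S: group S using S by (simp add: definable_group_def)
  interpret \<iota>: group_hom D G \<iota>
    using \<iota> by unfold_locales (simp add: definable_hom_def)
  interpret \<pi>: group_hom G S \<pi>
    using \<pi> by unfold_locales (simp add: definable_hom_def)
  have conj: "\<exists>e\<in>carrier D. \<iota> c \<otimes>\<^bsub>G\<^esub> h = h \<otimes>\<^bsub>G\<^esub> \<iota> e" if c: "c \<in> carrier D" and h: "h \<in> carrier G" for c h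
  proof -
    have \<iota>c: "\<iota> c \<in> carrier G" "\<pi> (\<iota> c) = \<one>\<^bsub>S\<^esub>" using c ker by (auto simp: kernel_def)
    let ?e = "inv\<^bsub>G\<^esub> h \<otimes>\<^bsub>G\<^esub> (\<iota> c \<otimes>\<^bsub>G\<^esub> h)"
    have "\<pi> ?e = \<one>\<^bsub>S\<^esub>" using \<iota>c h by simp
    then have "?e \<in> kernel G S \<pi>" using \<iota>c h by (simp add: kernel_def)
    then obtain e where e: "e \<in> carrier D" "\<iota> e = ?e" using ker by (metis imageE)
    have "h \<otimes>\<^bsub>G\<^esub> ?e = \<iota> c \<otimes>\<^bsub>G\<^esub> h" using \<iota>c h by (simp flip: G.m_assoc)
    then show ?thesis using e by metis
  qed
  have free: "\<exists>c\<in>carrier D. \<alpha> (\<iota> c) z \<noteq> z" if z: "z \<in> topspace X" for z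
  proof (rule ccontr)
    assume fixed: "\<not> ?thesis"
    define Fix where "Fix = (\<Inter>c\<in>carrier D. {x \<in> topspace X. \<alpha> (\<iota> c) x = id x})"
    have "z \<in> Fix" using z fixed by (simp add: Fix_def)
    have mem: "y \<in> Fix \<longleftrightarrow> y \<in> topspace X \<and> (\<forall>c\<in>carrier D. \<alpha> (\<iota> c) y = y)" for y
      using D.one_closed by (auto simp: Fix_def)
    have "subflow G X \<alpha> Fix"
      unfolding subflow_def
    proof (intro conjI ballI)
      show "closedin X Fix"
        unfolding Fix_def
      proof (rule closedin_INT)
        show "carrier D \<noteq> {}" using D.one_closed by blast
        show "closedin X {x \<in> topspace X. \<alpha> (\<iota> c) x = id x}" if "c \<in> carrier D" for c
          using closedin_continuous_maps_eq[OF f(4) f(9) continuous_map_id] that by simp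
      qed
      fix h y assume h: "h \<in> carrier G" and y: "y \<in> Fix"
      have yX: "y \<in> topspace X" using y mem by blast
      have "\<alpha> (\<iota> c) (\<alpha> h y) = \<alpha> h y" if c: "c \<in> carrier D" for c
      proof -
        obtain e where e: "e \<in> carrier D" "\<iota> c \<otimes>\<^bsub>G\<^esub> h = h \<otimes>\<^bsub>G\<^esub> \<iota> e" using conj[OF c h] by blast
        have "\<alpha> (\<iota> c) (\<alpha> h y) = \<alpha> (\<iota> c \<otimes>\<^bsub>G\<^esub> h) y" using c h yX f(7) by simp
        also have "\<dots> = \<alpha> h (\<alpha> (\<iota> e) y)" using e h yX f(7) by simp
        also have "\<alpha> (\<iota> e) y = y" using y mem e(1) by blast
        finally show ?thesis .
      qed
      then show "\<alpha> h y \<in> Fix" using mem f(5)[OF h yX] by blast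
    qed
    then have "Fix = topspace X" using min \<open>z \<in> Fix\<close> unfolding minimal_flow_def by blast
    then show False using mem x c moved by blast
  qed
  obtain x0 where x0: "x0 \<in> topspace X" using f(2) by blast
  have defG: "definable L M g (carrier G)" using G by (simp add: definable_group_def)
  have regular: "regular_space X" using f(3,4) compact_Hausdorff_or_regular_imp_normal_space
    by (metis compact_Hausdorff_imp_regular_space)
  have local: "\<exists>V c B. openin X V \<and> z \<in> V \<and> c \<in> carrier D \<and> definable_subset L M g G B \<and>
      (\<forall>h\<in>carrier G. \<alpha> h x0 \<in> V \<longrightarrow> h \<notin> B) \<and> (\<forall>h\<in>carrier G. h \<in> B \<or> \<iota> c \<otimes>\<^bsub>G\<^esub> h \<in> B)"
    if z: "z \<in> topspace X" for z
  proof -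
    obtain c where c: "c \<in> carrier D" "\<alpha> (\<iota> c) z \<noteq> z" using free[OF z] by blast
    have \<iota>c: "\<iota> c \<in> carrier G" using c(1) by simp
    obtain P Q where PQ: "openin X P" "openin X Q" "z \<in> P" "\<alpha> (\<iota> c) z \<in> Q" "disjnt P Q"
      using f(4) z f(5)[OF \<iota>c z] c(2) unfolding Hausdorff_space_def by metis
    define U where "U = P \<inter> {x \<in> topspace X. \<alpha> (\<iota> c) x \<in> Q}"
    have U: "openin X U"
      unfolding U_def using PQ f(9)[OF \<iota>c] by (intro openin_Int openin_continuous_map_preimage)
    have zU: "z \<in> U" using PQ z by (simp add: U_def)
    have off: "\<alpha> (\<iota> c) y \<notin> U" if "y \<in> U" for y using that PQ(5) by (auto simp: U_def disjnt_iff)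
    have "neighbourhood_base_of (closedin X) X" using regular by (simp add: neighbourhood_base_of_closedin)
    then obtain V C where V: "openin X V" "closedin X C" "z \<in> V" "V \<subseteq> C" "C \<subseteq> U"
      unfolding neighbourhood_base_of using U zU by meson
    obtain B where B: "definable_subset L M g G B"
      "\<And>h. h \<in> carrier G \<Longrightarrow> \<alpha> h x0 \<in> C \<Longrightarrow> h \<notin> B"
      "\<And>h. h \<in> carrier G \<Longrightarrow> h \<notin> B \<Longrightarrow> \<alpha> h x0 \<in> U"
      using definable_flow_separation[OF dfl M defG x0 V(2) U V(5)] by metis
    have "h \<in> B \<or> \<iota> c \<otimes>\<^bsub>G\<^esub> h \<in> B" if h: "h \<in> carrier G" for h
    proof (rule ccontr)
      assume "\<not> ?thesis"
      then have "\<alpha> h x0 \<in> U" "\<alpha> (\<iota> c \<otimes>\<^bsub>G\<^esub> h) x0 \<in> U" using B(3) h \<iota>c by auto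
      then show False using off f(7)[OF \<iota>c h x0] by auto
    qed
    then show ?thesis using V B(1,2) c(1) by (intro exI[of _ V] exI[of _ c] exI[of _ B]) auto
  qed
  obtain \<mu> :: "'a list set \<Rightarrow> real" where
    \<mu>0: "\<And>A. definable_subset L M d D A \<Longrightarrow> 0 \<le> \<mu> A" and \<mu>1: "\<mu> (carrier D) = 1" and
    add: "\<And>A B. definable_subset L M d D A \<Longrightarrow> definable_subset L M d D B \<Longrightarrow> A \<inter> B = {} \<Longrightarrow>
      \<mu> (A \<union> B) = \<mu> A + \<mu> B" and
    inv: "\<And>A h. h \<in> carrier D \<Longrightarrow> definable_subset L M d D A \<Longrightarrow> \<mu> (h <#\<^bsub>D\<^esub> A) = \<mu> A"
    using amenable unfolding definably_amenable_def by metis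
  obtain V cc B where VcB: "\<And>z. z \<in> topspace X \<Longrightarrow> openin X (V z) \<and> z \<in> V z \<and> cc z \<in> carrier D \<and>
      definable_subset L M g G (B z) \<and> (\<forall>h\<in>carrier G. \<alpha> h x0 \<in> V z \<longrightarrow> h \<notin> B z) \<and>
      (\<forall>h\<in>carrier G. h \<in> B z \<or> \<iota> (cc z) \<otimes>\<^bsub>G\<^esub> h \<in> B z)"
    using local by metis
  \<comment> \<open>If few \<open>d\<close> have \<open>h d \<in> B\<close>, then most have \<open>h d x0\<close> in the set that is moved off itself.\<close>
  have nets: "\<forall>z\<in>topspace X. \<exists>W. finite W \<and> W \<subseteq> topspace X \<and> (\<forall>h\<in>carrier G. \<alpha> h ` W \<subseteq> V z \<longrightarrow>
      \<mu> {x \<in> carrier D. h \<otimes>\<^bsub>G\<^esub> \<iota> x \<in> B z} < 1 / 2)" (is "\<forall>z\<in>_. ?net z")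
  proof
    fix z assume z: "z \<in> topspace X"
    show "?net z"
      by (rule finite_net_in_flow[OF M nip D G \<iota> \<mu>0 \<mu>1 add fl x0, of "V z" "B z"]) 
        (use VcB[OF z] in auto)
  qed
  obtain W where "\<forall>z\<in>topspace X. finite (W z) \<and> W z \<subseteq> topspace X \<and>
      (\<forall>h\<in>carrier G. \<alpha> h ` W z \<subseteq> V z \<longrightarrow> \<mu> {x \<in> carrier D. h \<otimes>\<^bsub>G\<^esub> \<iota> x \<in> B z} < 1 / 2)"
    using bchoice[OF nets] ..
  note W = bspec[OF this]
  have "\<exists>\<F>. finite \<F> \<and> \<F> \<subseteq> V ` topspace X \<and> topspace X \<subseteq> \<Union>\<F>"
    by (rule f(3)[unfolded compact_space_alt, rule_format]) (use VcB in auto)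
  then obtain \<F> where \<F>: "finite \<F>" "\<F> \<subseteq> V ` topspace X" "topspace X \<subseteq> \<Union>\<F>" by blast
  obtain Z where "Z \<subseteq> topspace X" "finite Z" "\<F> = V ` Z"
    using finite_subset_image[OF \<F>(1,2)] by blast
  then have Z: "finite Z" "Z \<subseteq> topspace X" "topspace X \<subseteq> \<Union>(V ` Z)" using \<F>(3) by auto
  obtain t where t: "t \<in> topspace X" "\<And>U. openin X U \<Longrightarrow> t \<in> U \<Longrightarrow> \<exists>h\<in>carrier G. \<alpha> h ` (\<Union>z\<in>Z. W z) \<subseteq> U"
  proof -
    have "finite (\<Union>z\<in>Z. W z)" "(\<Union>z\<in>Z. W z) \<subseteq> topspace X" using Z(1,2) W by auto
    then show thesis using proximal_contracts_finite[OF prox] that by meson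
  qed
  obtain z where z: "z \<in> Z" "t \<in> V z" using t(1) Z(3) by blast
  have zX: "z \<in> topspace X" using z(1) Z(2) by blast
  obtain h where h: "h \<in> carrier G" "\<alpha> h ` (\<Union>z\<in>Z. W z) \<subseteq> V z"
    using t(2)[of "V z"] VcB[OF zX] z(2) by blast
  define F where "F k = {x \<in> carrier D. k \<otimes>\<^bsub>G\<^esub> \<iota> x \<in> B z}" for k
  have "\<alpha> h ` W z \<subseteq> V z" using h(2) z(1) by blast
  then have small: "\<mu> (F h) < 1 / 2"
    unfolding F_def using W[OF zX] h(1) by blast
  have defF: "definable_subset L M d D (F k)" if "k \<in> carrier G" for k
  proof -
    have defB: "definable L M g (B z)" using VcB[OF zX] by (simp add: definable_subset_def)
    obtain R where R: "definable L M (d + g) R"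
      "\<And>h. h \<in> carrier G \<Longrightarrow> F h = {x \<in> tuples M d. x @ h \<in> R}"
      unfolding F_def using definable_translate[OF M D G \<iota> defB] by blast
    have "k \<in> tuples M g" using that definable_subset_tuples[OF defG] by blast
    then have "definable L M d (F k)" unfolding R(2)[OF that] by (rule definable_fiber[OF R(1)])
    then show ?thesis by (auto simp: definable_subset_def F_def)
  qed
  have cz: "cc z \<in> carrier D" using VcB[OF zX] by blast
  obtain e where e: "e \<in> carrier D" "\<iota> (cc z) \<otimes>\<^bsub>G\<^esub> h = h \<otimes>\<^bsub>G\<^esub> \<iota> e" using conj[OF cz h(1)] by blast
  have he: "h \<otimes>\<^bsub>G\<^esub> \<iota> e \<in> carrier G" using h(1) e(1) by simp
  have shift: "h \<otimes>\<^bsub>G\<^esub> \<iota> e \<otimes>\<^bsub>G\<^esub> \<iota> y = h \<otimes>\<^bsub>G\<^esub> \<iota> (e \<otimes>\<^bsub>D\<^esub> y)" if "y \<in> carrier D" for y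
    using that e(1) h(1) by (simp add: G.m_assoc)
  have "inv\<^bsub>D\<^esub> e <#\<^bsub>D\<^esub> F h = F (h \<otimes>\<^bsub>G\<^esub> \<iota> e)"
  proof
    show "inv\<^bsub>D\<^esub> e <#\<^bsub>D\<^esub> F h \<subseteq> F (h \<otimes>\<^bsub>G\<^esub> \<iota> e)"
    proof
      fix y assume "y \<in> inv\<^bsub>D\<^esub> e <#\<^bsub>D\<^esub> F h"
      then obtain a where a: "a \<in> F h" "y = inv\<^bsub>D\<^esub> e \<otimes>\<^bsub>D\<^esub> a" by (auto simp: l_coset_def)
      then have aD: "a \<in> carrier D" by (simp add: F_def)
      then have y: "y \<in> carrier D" "e \<otimes>\<^bsub>D\<^esub> y = a" using a(2) e(1) by (simp_all flip: D.m_assoc)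
      show "y \<in> F (h \<otimes>\<^bsub>G\<^esub> \<iota> e)" using shift[OF y(1)] y a(1) by (simp add: F_def)
    qed
    show "F (h \<otimes>\<^bsub>G\<^esub> \<iota> e) \<subseteq> inv\<^bsub>D\<^esub> e <#\<^bsub>D\<^esub> F h"
    proof
      fix y assume "y \<in> F (h \<otimes>\<^bsub>G\<^esub> \<iota> e)"
      then have "y \<in> carrier D" "e \<otimes>\<^bsub>D\<^esub> y \<in> F h" using e(1) shift[of y] by (auto simp: F_def)
      moreover from this have "y = inv\<^bsub>D\<^esub> e \<otimes>\<^bsub>D\<^esub> (e \<otimes>\<^bsub>D\<^esub> y)" using e(1) by (simp flip: D.m_assoc)
      ultimately show "y \<in> inv\<^bsub>D\<^esub> e <#\<^bsub>D\<^esub> F h" unfolding l_coset_def by blast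
    qed
  qed
  then have small': "\<mu> (F (h \<otimes>\<^bsub>G\<^esub> \<iota> e)) < 1 / 2"
    using inv[OF D.inv_closed[OF e(1)] defF[OF h(1)]] small by simp
  have "carrier D = F h \<union> F (h \<otimes>\<^bsub>G\<^esub> \<iota> e)"
  proof
    show "carrier D \<subseteq> F h \<union> F (h \<otimes>\<^bsub>G\<^esub> \<iota> e)"
    proof
      fix y assume y: "y \<in> carrier D"
      have "h \<otimes>\<^bsub>G\<^esub> \<iota> y \<in> B z \<or> \<iota> (cc z) \<otimes>\<^bsub>G\<^esub> (h \<otimes>\<^bsub>G\<^esub> \<iota> y) \<in> B z" using VcB[OF zX] h(1) y by simp
      moreover have "\<iota> (cc z) \<otimes>\<^bsub>G\<^esub> (h \<otimes>\<^bsub>G\<^esub> \<iota> y) = h \<otimes>\<^bsub>G\<^esub> \<iota> e \<otimes>\<^bsub>G\<^esub> \<iota> y"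
        using e h(1) y cz by (simp flip: G.m_assoc)
      ultimately show "y \<in> F h \<union> F (h \<otimes>\<^bsub>G\<^esub> \<iota> e)" using y by (auto simp: F_def)
    qed
  qed (auto simp: F_def)
  also have "\<dots> = F h \<union> (F (h \<otimes>\<^bsub>G\<^esub> \<iota> e) - F h)" by blast
  finally have "1 = \<mu> (F h \<union> (F (h \<otimes>\<^bsub>G\<^esub> \<iota> e) - F h))" using \<mu>1 by simp
  have defDiff: "definable_subset L M d D (A - C)" if "definable_subset L M d D A" "definable_subset L M d D C" for A C
    using that definable_Diff[OF M] by (auto simp: definable_subset_def)
  have defInt: "definable_subset L M d D (A \<inter> C)" if "definable_subset L M d D A" "definable_subset L M d D C" for A C
    using that definable_Int[OF M] by (auto simp: definable_subset_def)
  note d1 = defF[OF h(1)] and d2 = defF[OF he]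
  have "1 = \<mu> (F h) + \<mu> (F (h \<otimes>\<^bsub>G\<^esub> \<iota> e) - F h)"
    using \<open>1 = _\<close> add[OF d1 defDiff[OF d2 d1]] by auto
  moreover have "\<mu> (F (h \<otimes>\<^bsub>G\<^esub> \<iota> e)) = \<mu> (F (h \<otimes>\<^bsub>G\<^esub> \<iota> e) \<inter> F h) + \<mu> (F (h \<otimes>\<^bsub>G\<^esub> \<iota> e) - F h)"
    using add[OF defInt[OF d2 d1] defDiff[OF d2 d1]] by (simp add: Int_Diff_Un Int_Diff_disjoint)
  ultimately show False using small small' \<mu>0[OF defInt[OF d2 d1]] by linarith
qed

section \<open>Flows of a quotient group\<close>

lemma definable_hom_image:
  assumes M: "dom M \<noteq> {}" and G: "definable_group L M g G" and S: "definable_group L M s S"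
    and \<pi>: "definable_hom L M g G s S \<pi>" and A: "definable_subset L M g G A"
  shows "definable_subset L M s S (\<pi> ` A)"
proof -
  let ?\<Gamma> = "{x @ \<pi> x | x. x \<in> carrier G}"
  have GT: "carrier G \<subseteq> tuples M g" and ST: "carrier S \<subseteq> tuples M s"
    using G S unfolding definable_group_def by (blast dest: definable_subset_tuples)+
  have \<pi>S: "\<pi> x \<in> carrier S" if "x \<in> carrier G" for x
    using that \<pi> by (auto simp: definable_hom_def hom_def)
  have AG: "A \<subseteq> carrier G" using A by (simp add: definable_subset_def)
  have mem: "x @ y \<in> ?\<Gamma> \<longleftrightarrow> y = \<pi> x" if x: "x \<in> carrier G" for x y
  proof
    assume "x @ y \<in> ?\<Gamma>"
    then obtain x' where x': "x @ y = x' @ \<pi> x'" "x' \<in> carrier G" by blast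
    moreover have "length x = g" "length x' = g" using x x'(2) GT by (auto simp: tuples_def)
    ultimately show "y = \<pi> x" by simp
  qed (use x in blast)
  have "\<pi> ` A = {y \<in> tuples M s. \<exists>x\<in>A. x @ y \<in> ?\<Gamma>}"
  proof
    show "\<pi> ` A \<subseteq> {y \<in> tuples M s. \<exists>x\<in>A. x @ y \<in> ?\<Gamma>}" using AG \<pi>S ST by blast
    show "{y \<in> tuples M s. \<exists>x\<in>A. x @ y \<in> ?\<Gamma>} \<subseteq> \<pi> ` A" using mem AG by blast
  qed
  moreover have "definable L M s {y \<in> tuples M s. \<exists>x\<in>A. x @ y \<in> ?\<Gamma>}"
  proof (rule definable_relation_image[OF M])
    show "definable L M (g + s) ?\<Gamma>" using \<pi> unfolding definable_hom_def by blast
    show "definable L M g A" using A by (simp add: definable_subset_def)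
  qed
  ultimately have "definable L M s (\<pi> ` A)" by (simp only:)
  moreover have "\<pi> ` A \<subseteq> carrier S" using AG \<pi>S by blast
  ultimately show ?thesis by (simp add: definable_subset_def)
qed

lemma definable_hom_preimage:
  assumes M: "dom M \<noteq> {}" and G: "definable_group L M g G"
    and \<pi>: "definable_hom L M g G s S \<pi>" and A: "definable L M s A"
  shows "definable_subset L M g G {x \<in> carrier G. \<pi> x \<in> A}"
proof -
  let ?\<Gamma> = "{x @ \<pi> x | x. x \<in> carrier G}"
  have GT: "carrier G \<subseteq> tuples M g"
    using G unfolding definable_group_def by (blast dest: definable_subset_tuples)
  have mem: "x @ y \<in> ?\<Gamma> \<longleftrightarrow> x \<in> carrier G \<and> y = \<pi> x" if x: "x \<in> tuples M g" for x y
  proof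
    assume "x @ y \<in> ?\<Gamma>"
    then obtain x' where x': "x @ y = x' @ \<pi> x'" "x' \<in> carrier G" by blast
    moreover have "length x = g" "length x' = g" using x x'(2) GT by (auto simp: tuples_def)
    ultimately show "x \<in> carrier G \<and> y = \<pi> x" by simp
  qed blast
  have "{x \<in> carrier G. \<pi> x \<in> A} = {x \<in> tuples M g. \<exists>y\<in>A. x @ y \<in> ?\<Gamma>}"
  proof (intro equalityI subsetI)
    fix x assume "x \<in> {x \<in> carrier G. \<pi> x \<in> A}"
    then have "x \<in> tuples M g" "\<pi> x \<in> A" "x @ \<pi> x \<in> ?\<Gamma>" using GT by auto
    then show "x \<in> {x \<in> tuples M g. \<exists>y\<in>A. x @ y \<in> ?\<Gamma>}" by blast
  next
    fix x assume "x \<in> {x \<in> tuples M g. \<exists>y\<in>A. x @ y \<in> ?\<Gamma>}"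
    then obtain y where y: "x \<in> tuples M g" "y \<in> A" "x @ y \<in> ?\<Gamma>" by blast
    have "x \<in> carrier G \<and> y = \<pi> x" using y(3) by (rule mem[OF y(1), THEN iffD1])
    then show "x \<in> {x \<in> carrier G. \<pi> x \<in> A}" using y(2) by simp
  qed
  moreover have "definable L M g {x \<in> tuples M g. \<exists>y\<in>A. x @ y \<in> ?\<Gamma>}"
  proof (rule definable_relation_preimage[OF M _ A])
    show "definable L M (g + s) ?\<Gamma>" using \<pi> unfolding definable_hom_def by blast
  qed
  ultimately have "definable L M g {x \<in> carrier G. \<pi> x \<in> A}" by (simp only:)
  then show ?thesis by (simp add: definable_subset_def)
qed

lemma flow_along_surjection:
  assumes "group G" "group S" and \<pi>: "\<pi> \<in> hom G S" and surj: "\<pi> ` carrier G = carrier S"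
    and act: "\<And>h. h \<in> carrier G \<Longrightarrow> \<alpha> h = \<gamma> (\<pi> h)"
  shows "flow G X \<alpha> \<longleftrightarrow> flow S X \<gamma>"
proof -
  interpret G: group G by fact
  interpret S: group S by fact
  interpret \<pi>: group_hom G S \<pi> using \<pi> by unfold_locales
  have all: "(\<forall>h\<in>carrier G. P (\<alpha> h)) \<longleftrightarrow> (\<forall>h\<in>carrier S. P (\<gamma> h))" for P
    using act by (simp flip: surj)
  have "group_action G (topspace X) \<alpha> \<longleftrightarrow> group_action S (topspace X) \<gamma>"
  proof
    assume "group_action G (topspace X) \<alpha>"
    note a = group_action_act[OF this]
    show "group_action S (topspace X) \<gamma>"
    proof (rule group_actionI[OF S.is_group])
      fix k k' x assume k: "k \<in> carrier S" "k' \<in> carrier S" and x: "x \<in> topspace X"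
      then obtain h h' where h: "h \<in> carrier G" "h' \<in> carrier G" "k = \<pi> h" "k' = \<pi> h'"
        unfolding surj[symmetric] by blast
      then have "\<gamma> (k \<otimes>\<^bsub>S\<^esub> k') = \<alpha> (h \<otimes>\<^bsub>G\<^esub> h')" using act by simp
      then show "\<gamma> (k \<otimes>\<^bsub>S\<^esub> k') x = \<gamma> k (\<gamma> k' x)" using a(4) h x act by simp
    next
      show "\<gamma> \<one>\<^bsub>S\<^esub> x = x" if "x \<in> topspace X" for x
        using a(3)[OF that] act[OF G.one_closed] by simp
    next
      show "\<gamma> k x \<in> topspace X" if "k \<in> carrier S" "x \<in> topspace X" for k x
        using a(2) all[of "\<lambda>f. f x \<in> topspace X"] that by blast
      show "\<gamma> k \<in> extensional (topspace X)" if "k \<in> carrier S" for k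
        using a(5) all[of "\<lambda>f. f \<in> extensional (topspace X)"] that by blast
    qed
  next
    assume "group_action S (topspace X) \<gamma>"
    note a = group_action_act[OF this]
    show "group_action G (topspace X) \<alpha>"
      by (rule group_actionI[OF G.is_group]) (use a act in auto)
  qed
  then show ?thesis unfolding flow_def using all by blast
qed

text \<open>Both groups induce the same homeomorphisms.  Nets are transported along \<open>\<pi>\<close> in one direction
  and along a section of \<open>\<pi>\<close> in the other, separating sets by taking images and preimages.\<close>

lemma minimal_proximal_definable_flow_along_surjection:
  assumes M: "dom M \<noteq> {}" and G: "definable_group L M g G" and S: "definable_group L M s S"
    and \<pi>: "definable_hom L M g G s S \<pi>" and surj: "\<pi> ` carrier G = carrier S"
    and act: "\<And>h. h \<in> carrier G \<Longrightarrow> \<alpha> h = \<gamma> (\<pi> h)"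
  shows "minimal_proximal_definable_flow L M g G X \<alpha> \<longleftrightarrow> minimal_proximal_definable_flow L M s S X \<gamma>"
proof -
  have grp: "group G" "group S" using G S by (auto simp: definable_group_def)
  have hom: "\<pi> \<in> hom G S" using \<pi> by (simp add: definable_hom_def)
  have flow: "flow G X \<alpha> \<longleftrightarrow> flow S X \<gamma>" by (rule flow_along_surjection[where \<alpha> = \<alpha> and \<gamma> = \<gamma>, OF grp hom surj act])
  have \<pi>S: "\<pi> h \<in> carrier S" if "h \<in> carrier G" for h using that surj by blast
  define \<sigma> where "\<sigma> k = inv_into (carrier G) \<pi> k" for k
  have \<sigma>: "\<sigma> k \<in> carrier G" "\<pi> (\<sigma> k) = k" if "k \<in> carrier S" for k
    using that surj by (auto simp: \<sigma>_def f_inv_into_f inv_into_into)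
  have "subflow G X \<alpha> = subflow S X \<gamma>"
    by (rule ext) (use act in \<open>simp add: subflow_def flip: surj\<close>)
  then have minimal: "minimal_flow G X \<alpha> \<longleftrightarrow> minimal_flow S X \<gamma>"
    by (simp add: minimal_flow_def flow)
  have proximal: "proximal_flow G X \<alpha> \<longleftrightarrow> proximal_flow S X \<gamma>"
    unfolding proximal_flow_def flow
  proof (intro conj_cong refl ball_cong iffI)
    fix x y
    assume "\<exists>F z. F \<noteq> bot \<and> (\<forall>\<^sub>F h in F. h \<in> carrier G) \<and>
      limitin X (\<lambda>h. \<alpha> h x) z F \<and> limitin X (\<lambda>h. \<alpha> h y) z F"
    then obtain F z where F: "F \<noteq> bot" "\<forall>\<^sub>F h in F. h \<in> carrier G"
      "limitin X (\<lambda>h. \<alpha> h x) z F" "limitin X (\<lambda>h. \<alpha> h y) z F" by blast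
    have lim: "limitin X (\<lambda>k. \<gamma> k w) z (filtermap \<pi> F)" if "limitin X (\<lambda>h. \<alpha> h w) z F" for w
      unfolding limitin_def eventually_filtermap
    proof (intro conjI allI impI)
      show "z \<in> topspace X" using that by (simp add: limitin_def)
      fix U assume "openin X U \<and> z \<in> U"
      then have "\<forall>\<^sub>F h in F. \<alpha> h w \<in> U" using that by (simp add: limitin_def)
      with F(2) show "\<forall>\<^sub>F h in F. \<gamma> (\<pi> h) w \<in> U" by eventually_elim (simp add: act)
    qed
    have "\<forall>\<^sub>F k in filtermap \<pi> F. k \<in> carrier S"
      unfolding eventually_filtermap using F(2) by eventually_elim (rule \<pi>S)
    moreover have "filtermap \<pi> F \<noteq> bot" using F(1) by (simp add: filtermap_bot_iff)
    ultimately show "\<exists>F z. F \<noteq> bot \<and> (\<forall>\<^sub>F h in F. h \<in> carrier S) \<and>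
      limitin X (\<lambda>h. \<gamma> h x) z F \<and> limitin X (\<lambda>h. \<gamma> h y) z F"
      using lim[OF F(3)] lim[OF F(4)] by blast
  next
    fix x y
    assume "\<exists>F z. F \<noteq> bot \<and> (\<forall>\<^sub>F h in F. h \<in> carrier S) \<and>
      limitin X (\<lambda>h. \<gamma> h x) z F \<and> limitin X (\<lambda>h. \<gamma> h y) z F"
    then obtain F z where F: "F \<noteq> bot" "\<forall>\<^sub>F h in F. h \<in> carrier S"
      "limitin X (\<lambda>h. \<gamma> h x) z F" "limitin X (\<lambda>h. \<gamma> h y) z F" by blast
    have lim: "limitin X (\<lambda>h. \<alpha> h w) z (filtermap \<sigma> F)" if "limitin X (\<lambda>k. \<gamma> k w) z F" for w
      unfolding limitin_def eventually_filtermap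
    proof (intro conjI allI impI)
      show "z \<in> topspace X" using that by (simp add: limitin_def)
      fix U assume "openin X U \<and> z \<in> U"
      then have "\<forall>\<^sub>F k in F. \<gamma> k w \<in> U" using that by (simp add: limitin_def)
      with F(2) show "\<forall>\<^sub>F k in F. \<alpha> (\<sigma> k) w \<in> U" by eventually_elim (simp add: act \<sigma>)
    qed
    have "\<forall>\<^sub>F h in filtermap \<sigma> F. h \<in> carrier G"
      unfolding eventually_filtermap using F(2) by eventually_elim (rule \<sigma>)
    moreover have "filtermap \<sigma> F \<noteq> bot" using F(1) by (simp add: filtermap_bot_iff)
    ultimately show "\<exists>F z. F \<noteq> bot \<and> (\<forall>\<^sub>F h in F. h \<in> carrier G) \<and>
      limitin X (\<lambda>h. \<alpha> h x) z F \<and> limitin X (\<lambda>h. \<alpha> h y) z F"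
      using lim[OF F(3)] lim[OF F(4)] by blast
  qed
  have sep: "(\<exists>A. definable_subset L M g G A \<and>
      separates A {h \<in> carrier G. \<alpha> h x \<in> C\<^sub>1} {h \<in> carrier G. \<alpha> h x \<in> C\<^sub>2}) \<longleftrightarrow>
    (\<exists>A. definable_subset L M s S A \<and>
      separates A {k \<in> carrier S. \<gamma> k x \<in> C\<^sub>1} {k \<in> carrier S. \<gamma> k x \<in> C\<^sub>2})" for x C\<^sub>1 C\<^sub>2
  proof
    assume "\<exists>A. definable_subset L M g G A \<and>
      separates A {h \<in> carrier G. \<alpha> h x \<in> C\<^sub>1} {h \<in> carrier G. \<alpha> h x \<in> C\<^sub>2}"
    then obtain A where A: "definable_subset L M g G A"
      "separates A {h \<in> carrier G. \<alpha> h x \<in> C\<^sub>1} {h \<in> carrier G. \<alpha> h x \<in> C\<^sub>2}" by blast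
    have AG: "A \<subseteq> carrier G" using A(1) by (simp add: definable_subset_def)
    have sub: "{k \<in> carrier S. \<gamma> k x \<in> C} \<subseteq> \<pi> ` A" if "{h \<in> carrier G. \<alpha> h x \<in> C} \<subseteq> A" for C
    proof
      fix k assume k: "k \<in> {k \<in> carrier S. \<gamma> k x \<in> C}"
      then have "\<sigma> k \<in> A" using that \<sigma>[of k] act[of "\<sigma> k"] by auto
      then show "k \<in> \<pi> ` A" using \<sigma>(2)[of k] k by force
    qed
    have dis: "\<pi> ` A \<inter> {k \<in> carrier S. \<gamma> k x \<in> C} = {}" if "A \<inter> {h \<in> carrier G. \<alpha> h x \<in> C} = {}" for C
      using that AG act by force
    have "separates (\<pi> ` A) {k \<in> carrier S. \<gamma> k x \<in> C\<^sub>1} {k \<in> carrier S. \<gamma> k x \<in> C\<^sub>2}"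
      using A(2) unfolding separates_def
      by (elim disjE conjE) (rule disjI1 disjI2, intro conjI sub dis, assumption, assumption)+
    then show "\<exists>A. definable_subset L M s S A \<and>
        separates A {k \<in> carrier S. \<gamma> k x \<in> C\<^sub>1} {k \<in> carrier S. \<gamma> k x \<in> C\<^sub>2}"
      using definable_hom_image[OF M G S \<pi> A(1)] by blast
  next
    assume "\<exists>A. definable_subset L M s S A \<and>
      separates A {k \<in> carrier S. \<gamma> k x \<in> C\<^sub>1} {k \<in> carrier S. \<gamma> k x \<in> C\<^sub>2}"
    then obtain A where A: "definable_subset L M s S A"
      "separates A {k \<in> carrier S. \<gamma> k x \<in> C\<^sub>1} {k \<in> carrier S. \<gamma> k x \<in> C\<^sub>2}" by blast
    have sub: "{h \<in> carrier G. \<alpha> h x \<in> C} \<subseteq> {h \<in> carrier G. \<pi> h \<in> A}"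
      if "{k \<in> carrier S. \<gamma> k x \<in> C} \<subseteq> A" for C
      using that act \<pi>S by auto
    have dis: "{h \<in> carrier G. \<pi> h \<in> A} \<inter> {h \<in> carrier G. \<alpha> h x \<in> C} = {}"
      if "A \<inter> {k \<in> carrier S. \<gamma> k x \<in> C} = {}" for C
      using that act \<pi>S by auto
    have "separates {h \<in> carrier G. \<pi> h \<in> A} {h \<in> carrier G. \<alpha> h x \<in> C\<^sub>1} {h \<in> carrier G. \<alpha> h x \<in> C\<^sub>2}"
      using A(2) unfolding separates_def
      by (elim disjE conjE) (rule disjI1 disjI2, intro conjI sub dis, assumption, assumption)+
    moreover have "definable_subset L M g G {h \<in> carrier G. \<pi> h \<in> A}"
      using A(1) by (intro definable_hom_preimage[OF M G \<pi>]) (simp add: definable_subset_def)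
    ultimately show "\<exists>A. definable_subset L M g G A \<and>
        separates A {h \<in> carrier G. \<alpha> h x \<in> C\<^sub>1} {h \<in> carrier G. \<alpha> h x \<in> C\<^sub>2}" by blast
  qed
  show ?thesis
    by (simp add: minimal_proximal_definable_flow_def definable_flow_def flow minimal proximal sep)
qed

section \<open>The universal minimal proximal definable flow of an extension\<close>

theorem theorem3:
  fixes L :: "('f, 'r) lang" and T :: "('f, 'r) fm set" and M :: "('f, 'r, 'a) struct"
    and d g s :: nat and D G S :: "'a list monoid" and \<iota> \<pi> :: "'a list \<Rightarrow> 'a list"
    and X :: "'x topology" and \<alpha> :: "'a list \<Rightarrow> 'x \<Rightarrow> 'x"
    and Y :: "'y topology" and \<beta> :: "'a list \<Rightarrow> 'y \<Rightarrow> 'y"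
  assumes "complete_theory L T" and "nip_theory L T TYPE('a)" and "is_model L M T"
    and "definable_exact_sequence L M d D \<iota> g G \<pi> s S"
    and "definably_amenable L M d D"
    and "is_\<Pi>_def L M g G X \<alpha>" and "is_\<Pi>_def L M s S Y \<beta>"
  shows "isomorphic_flows G X \<alpha> Y (pullback_action \<pi> \<beta>)"
proof -
  have M: "dom M \<noteq> {}" using assms(3) by (simp add: is_model_def is_structure_def)
  have nip: "nip_formula M d n \<phi>" if "wf_fm L \<phi>" "fv \<phi> \<subseteq> {..<d + n}" for \<phi> n
    using that assms(2,3) by (simp add: nip_theory_def)
  have G: "definable_group L M g G" and S: "definable_group L M s S"
    and \<pi>: "definable_hom L M g G s S \<pi>" and ker: "\<iota> ` carrier D = kernel G S \<pi>"
    and surj: "\<pi> ` carrier G = carrier S"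
    using assms(4) by (auto simp: definable_exact_sequence_def)
  have X: "minimal_proximal_definable_flow L M g G X \<alpha>"
    and Y: "minimal_proximal_definable_flow L M s S Y \<beta>"
    using assms(6,7) by (auto simp: is_\<Pi>_def_def)
  have flX: "flow G X \<alpha>"
    using X by (simp add: minimal_proximal_definable_flow_def minimal_flow_def)
  note f = flowD[OF flX]
  interpret G: group G by (rule f)
  interpret S: group S using S by (simp add: definable_group_def)
  interpret \<pi>: group_hom G S \<pi>
    using \<pi> by unfold_locales (simp add: definable_hom_def)
  \<comment> \<open>The induced action of \<open>S\<close>; as the kernel acts trivially, any preimage of \<open>k\<close> does.\<close>
  define \<gamma> where "\<gamma> k = \<alpha> (inv_into (carrier G) \<pi> k)" for k
  have \<alpha>\<gamma>: "\<alpha> h = \<gamma> (\<pi> h)" if h: "h \<in> carrier G" for h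
  proof -
    define h' where "h' = inv_into (carrier G) \<pi> (\<pi> h)"
    have h': "h' \<in> carrier G" "\<pi> h' = \<pi> h"
      using h by (auto simp: h'_def inv_into_into f_inv_into_f)
    have "inv\<^bsub>G\<^esub> h' \<otimes>\<^bsub>G\<^esub> h \<in> kernel G S \<pi>" using h h' by (simp add: kernel_def)
    then obtain c where c: "c \<in> carrier D" "\<iota> c = inv\<^bsub>G\<^esub> h' \<otimes>\<^bsub>G\<^esub> h" using ker by (metis imageE)
    have "h' \<otimes>\<^bsub>G\<^esub> \<iota> c = h" using c h h' by (simp flip: G.m_assoc)
    have "\<alpha> h = \<alpha> h'"
    proof (rule extensionalityI[OF f(8)[OF h] f(8)[OF h'(1)]])
      fix x assume x: "x \<in> topspace X"
      have "\<alpha> h x = \<alpha> h' (\<alpha> (\<iota> c) x)"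
        using f(7)[OF h'(1) _ x, of "\<iota> c"] \<open>h' \<otimes>\<^bsub>G\<^esub> \<iota> c = h\<close> c(2) h h'(1) by simp
      also have "\<alpha> (\<iota> c) x = x"
        using definably_amenable_kernel_acts_trivially[OF M nip assms(4,5) X c(1) x] .
      finally show "\<alpha> h x = \<alpha> h' x" .
    qed
    then show ?thesis by (simp add: \<gamma>_def h'_def)
  qed
  have X': "minimal_proximal_definable_flow L M s S X \<gamma>"
    using minimal_proximal_definable_flow_along_surjection[where \<alpha> = \<alpha> and \<gamma> = \<gamma>, OF M G S \<pi> surj \<alpha>\<gamma>] X by simp
  have Y': "minimal_proximal_definable_flow L M g G Y (pullback_action \<pi> \<beta>)"
    using minimal_proximal_definable_flow_along_surjection[where \<alpha> = "pullback_action \<pi> \<beta>" and \<gamma> = \<beta>, OF M G S \<pi> surj] Y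
    by (simp add: pullback_action_def)
  obtain p where "flow_map G X \<alpha> Y (pullback_action \<pi> \<beta>) p"
    using is_\<Pi>_def_universal[OF assms(6) Y'] by blast
  moreover obtain q where "flow_map S Y \<beta> X \<gamma> q"
    using is_\<Pi>_def_universal[OF assms(7) X'] by blast
  then have "flow_map G Y (pullback_action \<pi> \<beta>) X \<alpha> q"
    using \<alpha>\<gamma> by (simp add: flow_map_def pullback_action_def)
  ultimately show ?thesis
    using X Y' unfolding minimal_proximal_definable_flow_def
    by (blast intro: minimal_proximal_isomorphic)
qed

end
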